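(* For any $0<\epsilon\leq 1/11$, every $d$-regular $\epsilon$-spectral expander on $2n$ vertices has at least $(d/e)^n\left(\frac{\epsilon}{2e^3d^6}\right)^{\epsilon n}$ perfect matchings.
   Context: For a graph $G$ on $2n$ vertices with adjacency matrix $A$ and diagonal degree matrix $D$, the normalized adjacency matrix is $\tilde A=D^{-1/2}AD^{-1/2}$, with eigenvalues $\lambda_1\geq\dots\geq\lambda_{2n}$; set $\sigma_2(\tilde A)=\max\{\lambda_2,|\lambda_{2n}|\}$. For $0<\epsilon<1$, $G$ is an $\epsilon$-spectral expander if $\sigma_2(\tilde A)\leq\epsilon$. *)

theory Defs
  imports Complex_Main "Jordan_Normal_Form.Char_Poly"
begin

definition simple_graph :: "nat \<Rightarrow> (nat \<Rightarrow> nat \<Rightarrow> bool) \<Rightarrow> bool" where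
  "simple_graph N E \<longleftrightarrow>
     (\<forall>i j. E i j \<longrightarrow> i < N \<and> j < N) \<and> (\<forall>i j. E i j \<longrightarrow> E j i) \<and> (\<forall>i. \<not> E i i)"

definition degree :: "nat \<Rightarrow> (nat \<Rightarrow> nat \<Rightarrow> bool) \<Rightarrow> nat \<Rightarrow> nat" where
  "degree N E i = card {j. j < N \<and> E i j}"

definition regular :: "nat \<Rightarrow> (nat \<Rightarrow> nat \<Rightarrow> bool) \<Rightarrow> nat \<Rightarrow> bool" where
  "regular N E d \<longleftrightarrow> (\<forall>i<N. degree N E i = d)"

definition adj_matrix :: "nat \<Rightarrow> (nat \<Rightarrow> nat \<Rightarrow> bool) \<Rightarrow> real mat" where
  "adj_matrix N E = mat N N (\<lambda>(i, j). if E i j then 1 else 0)"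

definition deg_inv_sqrt_matrix :: "nat \<Rightarrow> (nat \<Rightarrow> nat \<Rightarrow> bool) \<Rightarrow> real mat" where
  "deg_inv_sqrt_matrix N E =
     mat N N (\<lambda>(i, j). if i = j then 1 / sqrt (real (degree N E i)) else 0)"

definition norm_adj_matrix :: "nat \<Rightarrow> (nat \<Rightarrow> nat \<Rightarrow> bool) \<Rightarrow> real mat" where
  "norm_adj_matrix N E =
     deg_inv_sqrt_matrix N E * adj_matrix N E * deg_inv_sqrt_matrix N E"

text \<open>Eigenvalues of a (real symmetric) matrix, listed with multiplicity in
  non-increasing order: entry k of the list is lambda_(k+1).\<close>
definition eigenvalues_desc :: "real mat \<Rightarrow> real list" where
  "eigenvalues_desc A = rev (sorted_list_of_multiset (proots (char_poly A)))"

definition sigma2 :: "nat \<Rightarrow> (nat \<Rightarrow> nat \<Rightarrow> bool) \<Rightarrow> real" where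
  "sigma2 N E = (let ev = eigenvalues_desc (norm_adj_matrix N E)
                 in max (ev ! 1) \<bar>ev ! (N - 1)\<bar>)"

definition spectral_expander :: "nat \<Rightarrow> (nat \<Rightarrow> nat \<Rightarrow> bool) \<Rightarrow> real \<Rightarrow> bool" where
  "spectral_expander N E \<epsilon> \<longleftrightarrow> sigma2 N E \<le> \<epsilon>"

definition edges :: "nat \<Rightarrow> (nat \<Rightarrow> nat \<Rightarrow> bool) \<Rightarrow> nat set set" where
  "edges N E = {{i, j} | i j. i < N \<and> j < N \<and> E i j}"

definition perfect_matching :: "nat \<Rightarrow> (nat \<Rightarrow> nat \<Rightarrow> bool) \<Rightarrow> nat set set \<Rightarrow> bool" where
  "perfect_matching N E M \<longleftrightarrow>
     M \<subseteq> edges N E \<and> (\<forall>v<N. \<exists>!e. e \<in> M \<and> v \<in> e)"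

definition num_perfect_matchings :: "nat \<Rightarrow> (nat \<Rightarrow> nat \<Rightarrow> bool) \<Rightarrow> nat" where
  "num_perfect_matchings N E = card {M. perfect_matching N E M}"

end

theory Submission
  imports Defs "HOL-Analysis.Convex" "HOL-Library.Discrete_Functions"
    "Jordan_Normal_Form.Schur_Decomposition"
begin

text \<open>In an orthonormal eigenbasis of the normalized adjacency matrix the constant vectors span the
  leading axis, so the matrix shrinks vectors of sum zero by the factor \<open>\<epsilon>\<close>; this is the expander
  mixing lemma.

  Let \<open>m\<^sub>j\<close> be the number of matchings leaving \<open>2 j\<close> vertices uncovered. As long as
  \<open>j > \<epsilon> n\<close>, the mixing lemma provides about \<open>d j (j - \<epsilon> n) / n\<close> edges between uncovered
  vertices, so adding edges one at a time bounds \<open>m\<^sub>q\<close> for \<open>q = \<lfloor>\<epsilon> n\<rfloor>\<close> from below by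
  \<open>(d / e)\<^sup>n\<close> up to a factor of the permitted order. For \<open>1 \<le> j \<le> q\<close> let \<open>t\<close> be maximal with
  \<open>2\<^sup>t j \<le> \<epsilon> n\<close>. Expansion lets the sets reachable by alternating paths from two halves of the
  uncovered vertices double \<open>t\<close> times, after which at least \<open>2 n / 11\<close> augmenting paths with
  \<open>2 t + 1\<close> matching edges connect them. A matching \<open>M'\<close> arises from at most \<open>2 n d\<^bsup>2 t + 1\<^esup>\<close>
  such augmentations, whence \<open>m\<^sub>j \<le> 11 d\<^bsup>2 t + 1\<^esup> m\<^bsub>j - 1\<^esub>\<close>, and the exponents add up to at
  most \<open>3 \<epsilon> n\<close>.\<close>

unbundle no inner_syntax

section \<open>The spectral theorem for real symmetric matrices\<close>

lemma conjugate_of_real_mult_mat_vec: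
  fixes A :: "real mat"
  assumes "A \<in> carrier_mat n m" "v \<in> carrier_vec m"
  shows "conjugate (map_mat complex_of_real A *\<^sub>v v) = map_mat complex_of_real A *\<^sub>v conjugate v"
  using assms by (intro eq_vecI) (auto simp: scalar_prod_def)

lemma symmetric_mat_eigenvalue_real:
  fixes A :: "real mat"
  assumes A: "A \<in> carrier_mat n n" and sym: "A\<^sup>T = A"
    and eigenvalue: "eigenvalue (map_mat complex_of_real A) k"
  shows "k \<in> \<real>"
proof -
  let ?C = "map_mat complex_of_real A"
  have C: "?C \<in> carrier_mat n n" using A by simp
  from eigenvalue obtain v where v: "v \<in> carrier_vec n" "v \<noteq> 0\<^sub>v n" and Cv: "?C *\<^sub>v v = k \<cdot>\<^sub>v v"
    using A by (auto simp: eigenvalue_def eigenvector_def)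
  have "k * (v \<bullet>c v) = (?C *\<^sub>v v) \<bullet>c v" using v by (simp add: Cv)
  also have "\<dots> = (?C\<^sup>T *\<^sub>v v) \<bullet>c v" using sym by (simp add: map_mat_transpose)
  also have "\<dots> = v \<bullet> (?C *\<^sub>v conjugate v)"
    using transpose_vec_mult_scalar[OF C, of "conjugate v" v] v(1) by simp
  also have "\<dots> = v \<bullet> conjugate (k \<cdot>\<^sub>v v)"
    using conjugate_of_real_mult_mat_vec[OF A v(1)] by (simp add: Cv)
  also have "\<dots> = cnj k * (v \<bullet>c v)" using v(1) by (simp add: conjugate_smult_vec)
  finally have "cnj k = k" using v by simp
  then show ?thesis by (simp add: Reals_cnj_iff)
qed

lemma symmetric_mat_char_poly_splits:
  fixes A :: "real mat"
  assumes A: "A \<in> carrier_mat n n" and sym: "A\<^sup>T = A"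
  obtains es where "char_poly A = (\<Prod>e\<leftarrow>es. [:- e, 1:])"
proof -
  let ?C = "map_mat complex_of_real A"
  have C: "?C \<in> carrier_mat n n" using A by simp
  obtain as where as: "char_poly ?C = (\<Prod>a\<leftarrow>as. [:- a, 1:])"
    using char_poly_factorized[OF C] by blast
  have "eigenvalue ?C a" if "a \<in> set as" for a
    using that unfolding eigenvalue_root_char_poly[OF C] as by (auto simp: poly_prod_list)
  then have "map (\<lambda>a. complex_of_real (Re a)) as = as"
    by (intro map_idI) (simp add: symmetric_mat_eigenvalue_real[OF A sym])
  then have re: "(\<Prod>a\<leftarrow>map (\<lambda>a. complex_of_real (Re a)) as. [:- a, 1:]) = (\<Prod>a\<leftarrow>as. [:- a, 1:])"
    by simp
  interpret h: map_poly_inj_idom_hom complex_of_real ..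
  have "map_poly complex_of_real (\<Prod>e\<leftarrow>map Re as. [:- e, 1:])
      = (\<Prod>a\<leftarrow>map (\<lambda>a. complex_of_real (Re a)) as. [:- a, 1:])"
    by (simp add: h.hom_prod_list o_def)
  also have "\<dots> = map_poly complex_of_real (char_poly A)"
    unfolding re as[symmetric] by (rule of_real_hom.char_poly_hom[OF A])
  finally have "char_poly A = (\<Prod>e\<leftarrow>map Re as. [:- e, 1:])" by (simp add: h.eq_iff)
  then show thesis by (rule that)
qed

lemma symmetric_mat_char_poly_eigenvalues_desc:
  fixes A :: "real mat"
  assumes "A \<in> carrier_mat n n" "A\<^sup>T = A"
  shows "char_poly A = (\<Prod>e\<leftarrow>eigenvalues_desc A. [:- e, 1:])"
proof -
  obtain es where es: "char_poly A = (\<Prod>e\<leftarrow>es. [:- e, 1:])"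
    using symmetric_mat_char_poly_splits assms .
  have "proots (char_poly A) = (\<Sum>e\<leftarrow>es. {#e#})"
    unfolding es
    by (subst proots_prod_list[of "map (\<lambda>e. [:- e, 1:]) es", simplified]) (auto simp: o_def)
  also have "\<dots> = mset es" by (induction es) auto
  finally have "mset (eigenvalues_desc A) = mset es" by (simp add: eigenvalues_desc_def)
  then have "mset (map (\<lambda>e. [:- e, 1:]) es) = mset (map (\<lambda>e. [:- e, 1:]) (eigenvalues_desc A))"
    by simp
  then show ?thesis unfolding es by (metis prod_mset_prod_list)
qed

definition orthonormal_mat :: "nat \<Rightarrow> real mat \<Rightarrow> bool" where
  "orthonormal_mat n P \<longleftrightarrow> P \<in> carrier_mat n n \<and> P\<^sup>T * P = 1\<^sub>m n"

lemma orthonormal_matD: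
  assumes "orthonormal_mat n P"
  shows "P \<in> carrier_mat n n" "P\<^sup>T * P = 1\<^sub>m n" "P * P\<^sup>T = 1\<^sub>m n"
proof -
  show P: "P \<in> carrier_mat n n" and PP: "P\<^sup>T * P = 1\<^sub>m n"
    using assms by (auto simp: orthonormal_mat_def)
  show "P * P\<^sup>T = 1\<^sub>m n" by (rule mat_mult_left_right_inverse[OF _ P PP]) (use P in simp)
qed

lemma orthonormal_mat_mult:
  assumes P: "orthonormal_mat n P" and Q: "orthonormal_mat n Q"
  shows "orthonormal_mat n (P * Q)"
proof -
  note P = orthonormal_matD[OF P] and Q = orthonormal_matD[OF Q]
  have "(P * Q)\<^sup>T * (P * Q) = Q\<^sup>T * P\<^sup>T * (P * Q)" using P(1) Q(1) by (simp add: transpose_mult)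
  also have "\<dots> = Q\<^sup>T * (P\<^sup>T * P) * Q"
    using P(1) Q(1) by (simp add: assoc_mult_mat[of _ n n _ n _ n])
  also have "\<dots> = 1\<^sub>m n" using P Q by simp
  finally show ?thesis using P(1) Q(1) by (simp add: orthonormal_mat_def)
qed

lemma orthonormal_mat_four_block:
  assumes "orthonormal_mat n Q"
  shows "orthonormal_mat (Suc n) (four_block_mat (1\<^sub>m 1) (0\<^sub>m 1 n) (0\<^sub>m n 1) Q)"
proof -
  note Q = orthonormal_matD[OF assms]
  let ?B = "four_block_mat (1\<^sub>m 1) (0\<^sub>m 1 n) (0\<^sub>m n 1) Q"
  have "?B\<^sup>T = four_block_mat (1\<^sub>m 1) (0\<^sub>m 1 n) (0\<^sub>m n 1) Q\<^sup>T"
    using Q(1) by (simp add: transpose_four_block_mat[of _ 1 1 _ n _ n])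
  also have "\<dots> * ?B = four_block_mat (1\<^sub>m 1) (0\<^sub>m 1 n) (0\<^sub>m n 1) (1\<^sub>m n)"
    using Q(1,2) by (subst mult_four_block_mat[of _ 1 1 _ n _ n _ _ 1 _ n]) auto
  also have "\<dots> = 1\<^sub>m (Suc n)" by (intro eq_matI) auto
  finally show ?thesis using Q(1) by (auto simp: orthonormal_mat_def)
qed

lemma orthonormal_mat_scalar_prod:
  assumes P: "orthonormal_mat n P" and u: "u \<in> carrier_vec n" and v: "v \<in> carrier_vec n"
  shows "u \<bullet> v = (\<Sum>i<n. (P\<^sup>T *\<^sub>v u) $ i * (P\<^sup>T *\<^sub>v v) $ i)"
proof -
  note P = orthonormal_matD[OF P]
  have "u \<bullet> v = u \<bullet> (P *\<^sub>v (P\<^sup>T *\<^sub>v v))"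
    using P v by (simp flip: assoc_mult_mat_vec)
  also have "\<dots> = (P\<^sup>T *\<^sub>v u) \<bullet> (P\<^sup>T *\<^sub>v v)"
    by (rule transpose_vec_mult_scalar[symmetric]) (use P(1) u v in auto)
  also have "\<dots> = (\<Sum>i<n. (P\<^sup>T *\<^sub>v u) $ i * (P\<^sup>T *\<^sub>v v) $ i)"
    unfolding scalar_prod_def using P(1) by (simp add: atLeast0LessThan)
  finally show ?thesis .
qed

definition normalize_vec :: "real vec \<Rightarrow> real vec" where
  "normalize_vec v = (1 / sqrt (v \<bullet> v)) \<cdot>\<^sub>v v"

lemma normalize_vec_scalar_prod:
  assumes "v \<in> carrier_vec n" "w \<in> carrier_vec n"
  shows "normalize_vec v \<bullet> normalize_vec w = (v \<bullet> w) / (sqrt (v \<bullet> v) * sqrt (w \<bullet> w))"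
  using assms by (simp add: normalize_vec_def)

lemma orthonormal_mat_of_corthogonal:
  assumes ws: "corthogonal ws" "set ws \<subseteq> carrier_vec n" "length ws = n"
  shows "orthonormal_mat n (mat_of_cols n (map normalize_vec ws))"
proof -
  define W where "W = mat_of_cols n (map normalize_vec ws)"
  have W: "W \<in> carrier_mat n n"
    using ws(3) mat_of_cols_carrier(1)[of n "map normalize_vec ws"] by (simp add: W_def)
  have w: "ws ! i \<in> carrier_vec n" if "i < n" for i using ws(2,3) that by auto
  have col: "col W i = normalize_vec (ws ! i)" if "i < n" for i
    using that w ws(3) unfolding W_def by (subst col_mat_of_cols) (auto simp: normalize_vec_def)
  have "(W\<^sup>T * W) $$ (i, j) = 1\<^sub>m n $$ (i, j)" if ij: "i < n" "j < n" for i j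
  proof -
    have "(W\<^sup>T * W) $$ (i, j) = normalize_vec (ws ! i) \<bullet> normalize_vec (ws ! j)"
      using ij W by (simp add: col)
    also have "\<dots> = (ws ! i \<bullet> ws ! j) / (sqrt (ws ! i \<bullet> ws ! i) * sqrt (ws ! j \<bullet> ws ! j))"
      by (rule normalize_vec_scalar_prod[OF w[OF ij(1)] w[OF ij(2)]])
    also have "\<dots> = 1\<^sub>m n $$ (i, j)"
    proof (cases "i = j")
      case True
      have "ws ! i \<bullet> ws ! i > 0"
        using corthogonalD[OF ws(1), of i i] conjugate_square_ge_0_vec[of "ws ! i"] ij(1) ws(3)
        by (simp add: less_le)
      then show ?thesis using True ij by simp
    next
      case False
      then show ?thesis using corthogonalD[OF ws(1), of i j] ij ws(3) by simp
    qed
    finally show ?thesis .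
  qed
  then show ?thesis using W unfolding W_def by (auto simp: orthonormal_mat_def intro!: eq_matI)
qed

lemma orthonormal_mat_with_first_col:
  assumes v: "v \<in> carrier_vec n" "v \<noteq> 0\<^sub>v n"
  obtains W where "orthonormal_mat n W" "col W 0 = normalize_vec v"
proof -
  interpret cof_vec_space n "TYPE(real)" .
  note basis = basis_completion[OF v]
  define ws where "ws = gram_schmidt n (basis_completion v)"
  note gs = gram_schmidt_result[OF basis(2,4,5) ws_def]
  have len: "length ws = n" using gs(4) basis(6) by simp
  have n: "0 < n" using v by (cases n) auto
  have "hd ws = v"
    using basis(6,7) n gram_schmidt_hd[OF v(1)] by (cases "basis_completion v") (auto simp: ws_def)
  then have "ws ! 0 = v" using len n by (cases ws) auto
  then have "col (mat_of_cols n (map normalize_vec ws)) 0 = normalize_vec v"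
    using n len v(1) by (subst col_mat_of_cols) (auto simp: normalize_vec_def)
  then show thesis using orthonormal_mat_of_corthogonal[OF gs(2,3) len] that by blast
qed

lemma orthonormal_mat_conjugate:
  assumes A: "A \<in> carrier_mat n n" and W: "orthonormal_mat n W"
  shows "char_poly (W\<^sup>T * A * W) = char_poly A" "A * W = W * (W\<^sup>T * A * W)"
proof -
  note W = orthonormal_matD[OF W]
  have "similar_mat_wit (W\<^sup>T * A * W) A W\<^sup>T W"
    by (rule similar_mat_witI[of _ _ n]) (use A W in auto)
  then show "char_poly (W\<^sup>T * A * W) = char_poly A"
    by (intro char_poly_similar) (auto simp: similar_mat_def)
  have "W * (W\<^sup>T * A * W) = W * W\<^sup>T * A * W"
    using A W(1) by (simp add: assoc_mult_mat[of _ n n _ n _ n])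
  then show "A * W = W * (W\<^sup>T * A * W)" using A W by simp
qed

lemma symmetric_mat_split_eigenvector:
  fixes A :: "real mat"
  assumes A: "A \<in> carrier_mat (Suc n) (Suc n)" and sym: "A\<^sup>T = A" and e: "eigenvalue A e"
  obtains W A' where "orthonormal_mat (Suc n) W" "A' \<in> carrier_mat n n" "A'\<^sup>T = A'"
    "W\<^sup>T * A * W = four_block_mat (mat 1 1 (\<lambda>_. e)) (0\<^sub>m 1 n) (0\<^sub>m n 1) A'"
proof -
  note assoc = assoc_mult_mat[of _ "Suc n" "Suc n" _ "Suc n" _ "Suc n"]
  note col_mult2 = col_mult2[of _ "Suc n" "Suc n" _ "Suc n"]
  obtain v where v: "v \<in> carrier_vec (Suc n)" "v \<noteq> 0\<^sub>v (Suc n)" and Av: "A *\<^sub>v v = e \<cdot>\<^sub>v v"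
    using e A by (auto simp: eigenvalue_def eigenvector_def)
  obtain W where W: "orthonormal_mat (Suc n) W" and W0: "col W 0 = normalize_vec v"
    using orthonormal_mat_with_first_col[OF v] .
  note WD = orthonormal_matD[OF W]
  define B where "B = W\<^sup>T * A * W"
  define A' where "A' = mat n n (\<lambda>(i, j). B $$ (Suc i, Suc j))"
  have B: "B \<in> carrier_mat (Suc n) (Suc n)" using A WD(1) by (simp add: B_def)
  have "B\<^sup>T = B"
    using A WD(1) sym
    by (simp add: B_def transpose_mult[of _ "Suc n" "Suc n" _ "Suc n"] assoc)
  then have Bsym: "B $$ (i, j) = B $$ (j, i)" if "i < Suc n" "j < Suc n" for i j
    using B that by (metis carrier_matD index_transpose_mat(1))
  have "A *\<^sub>v col W 0 = e \<cdot>\<^sub>v col W 0"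
    using A v(1)
    by (simp add: W0 normalize_vec_def Av mult_mat_vec smult_smult_assoc mult.commute)
  then have "col B 0 = W\<^sup>T *\<^sub>v (e \<cdot>\<^sub>v col W 0)"
    using A WD(1) by (simp add: B_def assoc col_mult2 del: col_mult)
  also have "\<dots> = e \<cdot>\<^sub>v (W\<^sup>T *\<^sub>v col W 0)"
    by (rule mult_mat_vec[of _ "Suc n" "Suc n"]) (use WD(1) in \<open>auto intro: carrier_vecI\<close>)
  also have "W\<^sup>T *\<^sub>v col W 0 = col (W\<^sup>T * W) 0"
    using WD(1) by (simp add: col_mult2 del: col_mult)
  finally have col_B: "col B 0 = e \<cdot>\<^sub>v col (1\<^sub>m (Suc n)) 0" using WD(2) by simp
  have B0: "B $$ (i, 0) = (if i = 0 then e else 0)" if i: "i < Suc n" for i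
  proof -
    have "B $$ (i, 0) = col B 0 $ i" using i B by simp
    then show ?thesis using i by (simp add: col_B)
  qed
  have "B = four_block_mat (mat 1 1 (\<lambda>_. e)) (0\<^sub>m 1 n) (0\<^sub>m n 1) A'"
    using B by (intro eq_matI) (auto simp: A'_def B0 Bsym[of 0] less_Suc_eq_0_disj)
  moreover have "A'\<^sup>T = A'" by (rule eq_matI) (auto simp: A'_def Bsym)
  ultimately show thesis using W by (intro that[of W A']) (auto simp: A'_def B_def)
qed

lemma char_poly_four_block_singleton:
  assumes "A \<in> carrier_mat n n"
  shows "char_poly (four_block_mat (mat 1 1 (\<lambda>_. e)) (0\<^sub>m 1 n) (0\<^sub>m n 1) A)
    = [:- e, 1:] * char_poly A"
proof -
  have "char_poly (mat 1 1 (\<lambda>_. e)) = [:- e, 1:]"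
    by (subst char_poly_upper_triangular[of _ 1]) (auto simp: diag_mat_def)
  then show ?thesis
    using assms char_poly_four_block_zeros_col[of "mat 1 1 (\<lambda>_. e)" "0\<^sub>m 1 n" n A] by simp
qed

lemma four_block_mat_diagonalization:
  fixes A Q :: "real mat"
  assumes A: "A \<in> carrier_mat n n" and Q: "Q \<in> carrier_mat n n"
    and AQ: "A * Q = Q * mat_diag n ((!) es)"
  shows "four_block_mat (mat 1 1 (\<lambda>_. e)) (0\<^sub>m 1 n) (0\<^sub>m n 1) A
        * four_block_mat (1\<^sub>m 1) (0\<^sub>m 1 n) (0\<^sub>m n 1) Q
      = four_block_mat (1\<^sub>m 1) (0\<^sub>m 1 n) (0\<^sub>m n 1) Q * mat_diag (Suc n) ((!) (e # es))"
proof -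
  have diag: "mat_diag (Suc n) ((!) (e # es))
      = four_block_mat (mat 1 1 (\<lambda>_. e)) (0\<^sub>m 1 n) (0\<^sub>m n 1) (mat_diag n ((!) es))"
    by (rule eq_matI) (auto simp: mat_diag_def nth_Cons')
  show ?thesis
    unfolding diag using A Q
    by (subst (1 2) mult_four_block_mat[of _ 1 1 _ n _ n _ _ 1 _ n])
       (auto simp: AQ left_mult_zero_mat[OF mat_diag_dim])
qed

theorem symmetric_mat_diagonalization:
  fixes A :: "real mat"
  assumes "A \<in> carrier_mat n n" "A\<^sup>T = A" "char_poly A = (\<Prod>e\<leftarrow>es. [:- e, 1:])"
  shows "\<exists>P. orthonormal_mat n P \<and> A * P = P * mat_diag n ((!) es)"
  using assms
proof (induction es arbitrary: n A)
  case Nil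
  then have n: "n = 0" using degree_monic_char_poly[of A n] by simp
  have "A * 1\<^sub>m 0 = 1\<^sub>m 0 * mat_diag 0 ((!) [])"
    using Nil(1) n by (intro eq_matI) (auto simp: mat_diag_def)
  then show ?case using n by (intro exI[of _ "1\<^sub>m 0"]) (auto simp: orthonormal_mat_def)
next
  case (Cons e es)
  note A = Cons.prems(1)
  have e: "eigenvalue A e"
    unfolding eigenvalue_root_char_poly[OF A] Cons.prems(3) by simp
  have "n \<noteq> 0" using e A by (auto simp: eigenvalue_def eigenvector_def)
  then obtain m where n: "n = Suc m" by (cases n) auto
  obtain W A' where W: "orthonormal_mat n W" and A': "A' \<in> carrier_mat m m" "A'\<^sup>T = A'"
    and block: "W\<^sup>T * A * W = four_block_mat (mat 1 1 (\<lambda>_. e)) (0\<^sub>m 1 m) (0\<^sub>m m 1) A'"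
    using symmetric_mat_split_eigenvector[of A m e] A Cons.prems(2) e n by blast
  have "[:- e, 1:] * (\<Prod>e\<leftarrow>es. [:- e, 1:]) = char_poly (W\<^sup>T * A * W)"
    using orthonormal_mat_conjugate(1)[OF A W] Cons.prems(3) by simp
  also have "\<dots> = [:- e, 1:] * char_poly A'"
    unfolding block by (rule char_poly_four_block_singleton[OF A'(1)])
  finally have "char_poly A' = (\<Prod>e\<leftarrow>es. [:- e, 1:])"
    by (subst (asm) mult_left_cancel) auto
  then obtain Q where Q: "orthonormal_mat m Q" and AQ: "A' * Q = Q * mat_diag m ((!) es)"
    using Cons.IH A' by blast
  let ?Q = "four_block_mat (1\<^sub>m 1) (0\<^sub>m 1 m) (0\<^sub>m m 1) Q"
  have Q': "orthonormal_mat n ?Q" unfolding n by (rule orthonormal_mat_four_block[OF Q])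
  note carrier = orthonormal_matD(1)[OF W] orthonormal_matD(1)[OF Q']
  have "A * (W * ?Q) = A * W * ?Q" by (rule assoc_mult_mat[OF A carrier, symmetric])
  also have "A * W = W * (W\<^sup>T * A * W)" by (rule orthonormal_mat_conjugate(2)[OF A W])
  also have "\<dots> * ?Q = W * ((W\<^sup>T * A * W) * ?Q)"
    by (rule assoc_mult_mat[of _ n n _ n _ n]) (use A carrier in auto)
  also have "\<dots> = W * (?Q * mat_diag n ((!) (e # es)))"
    unfolding block n four_block_mat_diagonalization[OF A'(1) orthonormal_matD(1)[OF Q] AQ] ..
  also have "\<dots> = W * ?Q * mat_diag n ((!) (e # es))"
    using carrier by (simp add: assoc_mult_mat[of _ n n _ n _ n])
  finally show ?case using orthonormal_mat_mult[OF W Q'] by blast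
qed

section \<open>The spectral gap\<close>

lemma index_mat_diag_mult_vec:
  assumes "v \<in> carrier_vec n" "i < n"
  shows "(mat_diag n f *\<^sub>v v) $ i = f i * v $ i"
proof -
  have "(mat_diag n f *\<^sub>v v) $ i = (\<Sum>j<n. (if i = j then f j else 0) * v $ j)"
    using assms by (simp add: mat_diag_def scalar_prod_def atLeast0LessThan)
  also have "\<dots> = (\<Sum>j<n. if j = i then f i * v $ j else 0)" by (intro sum.cong) auto
  finally show ?thesis using assms(2) by simp
qed

lemma diagonalization_mult_mat_vec:
  assumes P: "orthonormal_mat n P" and A: "A \<in> carrier_mat n n" and AP: "A * P = P * mat_diag n f"
    and g: "g \<in> carrier_vec n" and i: "i < n"
  shows "(P\<^sup>T *\<^sub>v (A *\<^sub>v g)) $ i = f i * (P\<^sup>T *\<^sub>v g) $ i"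
proof -
  note P = orthonormal_matD[OF P]
  have PT: "P\<^sup>T \<in> carrier_mat n n" using P(1) by simp
  have "P\<^sup>T * A = P\<^sup>T * A * (P * P\<^sup>T)" using P A by simp
  also have "\<dots> = P\<^sup>T * (A * P) * P\<^sup>T" using P(1) A by (simp add: assoc_mult_mat[of _ n n _ n _ n])
  also have "\<dots> = (P\<^sup>T * P) * mat_diag n f * P\<^sup>T"
    unfolding AP using P(1) by (simp add: assoc_mult_mat[of _ n n _ n _ n])
  finally have PA: "P\<^sup>T * A = mat_diag n f * P\<^sup>T"
    using P by (simp add: left_mult_one_mat[OF mat_diag_dim])
  have "P\<^sup>T *\<^sub>v (A *\<^sub>v g) = mat_diag n f *\<^sub>v (P\<^sup>T *\<^sub>v g)"
    using PT A g by (simp add: PA flip: assoc_mult_mat_vec[of _ n n _ n])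
  then show ?thesis using PT g i by (simp add: index_mat_diag_mult_vec)
qed

lemma diagonalization_eigenvector_coordinate:
  assumes P: "orthonormal_mat n P" and A: "A \<in> carrier_mat n n" and AP: "A * P = P * mat_diag n f"
    and v: "v \<in> carrier_vec n" "A *\<^sub>v v = \<mu> \<cdot>\<^sub>v v" and i: "i < n" "f i \<noteq> \<mu>"
  shows "(P\<^sup>T *\<^sub>v v) $ i = 0"
proof -
  have "\<mu> * (P\<^sup>T *\<^sub>v v) $ i = f i * (P\<^sup>T *\<^sub>v v) $ i"
    using diagonalization_mult_mat_vec[OF P A AP v(1) i(1)] v i(1) orthonormal_matD(1)[OF P] by simp
  then show ?thesis using i(2) by simp
qed

lemma orthonormal_mat_first_coordinate:
  assumes P: "orthonormal_mat n P" and v: "v \<in> carrier_vec n" "v \<noteq> 0\<^sub>v n"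
    and coord_v: "\<And>i. 0 < i \<Longrightarrow> i < n \<Longrightarrow> (P\<^sup>T *\<^sub>v v) $ i = 0"
    and g: "g \<in> carrier_vec n" "g \<bullet> v = 0"
  shows "(P\<^sup>T *\<^sub>v g) $ 0 = 0"
proof -
  have "0 < n" using v by (cases n) auto
  then have "{..<n} = insert 0 {0<..<n}" by auto
  then have "u \<bullet> v = (P\<^sup>T *\<^sub>v u) $ 0 * (P\<^sup>T *\<^sub>v v) $ 0" if "u \<in> carrier_vec n" for u
    using orthonormal_mat_scalar_prod[OF P that v(1)] coord_v by simp
  moreover have "v \<bullet> v \<noteq> 0" using conjugate_square_eq_0_vec[OF v(1)] v(2) by simp
  ultimately show ?thesis using v(1) g by fastforce
qed

lemma symmetric_mat_contraction:
  fixes A :: "real mat"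
  assumes A: "A \<in> carrier_mat n n" "A\<^sup>T = A"
    and v: "v \<in> carrier_vec n" "v \<noteq> 0\<^sub>v n" "A *\<^sub>v v = \<mu> \<cdot>\<^sub>v v"
    and gap: "c < \<mu>" "\<And>i. 0 < i \<Longrightarrow> i < n \<Longrightarrow> \<bar>eigenvalues_desc A ! i\<bar> \<le> c"
    and g: "g \<in> carrier_vec n" "g \<bullet> v = 0"
  shows "(A *\<^sub>v g) \<bullet> (A *\<^sub>v g) \<le> c\<^sup>2 * (g \<bullet> g)"
proof -
  let ?e = "(!) (eigenvalues_desc A)"
  obtain P where P: "orthonormal_mat n P" and AP: "A * P = P * mat_diag n ?e"
    using symmetric_mat_diagonalization[OF A symmetric_mat_char_poly_eigenvalues_desc[OF A]]
    by blast
  have coord_v: "(P\<^sup>T *\<^sub>v v) $ i = 0" if i: "0 < i" "i < n" for i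
  proof -
    have "?e i \<noteq> \<mu>" using gap(1) gap(2)[OF i] by auto
    then show ?thesis by (rule diagonalization_eigenvector_coordinate[OF P A(1) AP v(1,3) i(2)])
  qed
  have coord_g: "(P\<^sup>T *\<^sub>v g) $ 0 = 0"
    by (rule orthonormal_mat_first_coordinate[OF P v(1,2) coord_v g])
  have "(A *\<^sub>v g) \<bullet> (A *\<^sub>v g) = (\<Sum>i<n. (?e i * (P\<^sup>T *\<^sub>v g) $ i)\<^sup>2)"
    using orthonormal_mat_scalar_prod[OF P, of "A *\<^sub>v g" "A *\<^sub>v g"] A(1) g(1)
    by (simp add: diagonalization_mult_mat_vec[OF P A(1) AP] power2_eq_square)
  also have "\<dots> \<le> (\<Sum>i<n. c\<^sup>2 * ((P\<^sup>T *\<^sub>v g) $ i)\<^sup>2)"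
  proof (rule sum_mono)
    fix i assume i: "i \<in> {..<n}"
    show "(?e i * (P\<^sup>T *\<^sub>v g) $ i)\<^sup>2 \<le> c\<^sup>2 * ((P\<^sup>T *\<^sub>v g) $ i)\<^sup>2"
    proof (cases "i = 0")
      case False
      then have "(?e i)\<^sup>2 \<le> c\<^sup>2"
        using gap(2)[of i] i by (intro abs_le_square_iff[THEN iffD1]) auto
      then show ?thesis unfolding power_mult_distrib by (rule mult_right_mono) simp
    qed (simp add: coord_g)
  qed
  also have "\<dots> = c\<^sup>2 * (g \<bullet> g)"
    using orthonormal_mat_scalar_prod[OF P g(1) g(1)]
    by (simp add: power2_eq_square sum_distrib_left)
  finally show ?thesis .
qed

lemma length_eigenvalues_desc:
  assumes "A \<in> carrier_mat n n" "A\<^sup>T = A"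
  shows "length (eigenvalues_desc A) = n"
proof -
  have "Polynomial.degree (char_poly A) = length (eigenvalues_desc A)"
    unfolding symmetric_mat_char_poly_eigenvalues_desc[OF assms] by (rule degree_linear_factors)
  then show ?thesis using degree_monic_char_poly[OF assms(1)] by simp
qed

lemma abs_eigenvalues_desc_le:
  assumes "A \<in> carrier_mat n n" "A\<^sup>T = A" and i: "0 < i" "i < n"
  shows "\<bar>eigenvalues_desc A ! i\<bar> \<le> max (eigenvalues_desc A ! 1) \<bar>eigenvalues_desc A ! (n - 1)\<bar>"
proof -
  have "sorted (rev (eigenvalues_desc A))" by (simp add: eigenvalues_desc_def)
  then have "eigenvalues_desc A ! k \<le> eigenvalues_desc A ! j" if "j \<le> k" "k < n" for j k
    using that length_eigenvalues_desc[OF assms(1,2)] by (simp add: sorted_rev_nth_mono)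
  from this[of 1 i] this[of i "n - 1"]
  have "eigenvalues_desc A ! i \<le> eigenvalues_desc A ! 1"
    "eigenvalues_desc A ! (n - 1) \<le> eigenvalues_desc A ! i"
    using i by auto
  then show ?thesis by linarith
qed

section \<open>The expander mixing lemma\<close>

locale regular_graph =
  fixes N d :: nat and E :: "nat \<Rightarrow> nat \<Rightarrow> bool"
  assumes simple: "simple_graph N E" and regular: "regular N E d" and d_pos: "1 \<le> d"
begin

lemma E_less: "E i j \<Longrightarrow> i < N" "E i j \<Longrightarrow> j < N"
  and E_sym: "E i j \<Longrightarrow> E j i"
  and E_irrefl: "\<not> E i i"
  using simple unfolding simple_graph_def by blast+

lemma E_commute: "E i j \<longleftrightarrow> E j i"
  using E_sym by blast

lemma degree_eq: "i < N \<Longrightarrow> Defs.degree N E i = d"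
  using regular by (simp add: regular_def)

lemma finite_neighbours: "finite {j. E i j}"
  by (rule finite_subset[of _ "{..<N}"]) (use E_less in auto)

lemma card_neighbours: "i < N \<Longrightarrow> card {j. E i j} = d"
  using degree_eq[of i] E_less(2) unfolding Defs.degree_def
  by (metis (mono_tags, lifting) Collect_cong)

lemma card_neighbours_le: "card {j. E i j} \<le> d"
proof (cases "i < N")
  case False
  then have "{j. E i j} = {}" using E_less(1) by blast
  then show ?thesis by simp
qed (simp add: card_neighbours)

lemma norm_adj_matrix_eq: "norm_adj_matrix N E = (1 / real d) \<cdot>\<^sub>m adj_matrix N E"
proof -
  have "deg_inv_sqrt_matrix N E = mat_diag N (\<lambda>_. 1 / sqrt (real d))"
    by (rule eq_matI) (auto simp: deg_inv_sqrt_matrix_def mat_diag_def degree_eq)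
  moreover have "adj_matrix N E \<in> carrier_mat N N" by (simp add: adj_matrix_def)
  ultimately show ?thesis
    by (intro eq_matI)
       (auto simp: norm_adj_matrix_def mat_diag_mult_left[of _ N N] mat_diag_mult_right[of _ N N])
qed

lemma norm_adj_matrix_symmetric:
  "norm_adj_matrix N E \<in> carrier_mat N N" "(norm_adj_matrix N E)\<^sup>T = norm_adj_matrix N E"
  by (auto simp: norm_adj_matrix_eq adj_matrix_def E_commute)

definition neighbour_average :: "(nat \<Rightarrow> real) \<Rightarrow> nat \<Rightarrow> real" where
  "neighbour_average g i = (\<Sum>j | E i j. g j) / real d"

lemma sum_neighbours: "(\<Sum>j | E i j. g j) = (\<Sum>j<N. if E i j then g j else (0 :: real))"
proof -
  have "(\<Sum>j | E i j. g j) = (\<Sum>j\<in>{..<N} \<inter> {j. E i j}. g j)"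
    using E_less(2) by (intro sum.cong) auto
  then show ?thesis by (simp add: sum.inter_restrict)
qed

lemma norm_adj_matrix_mult_vec:
  "norm_adj_matrix N E *\<^sub>v vec N g = vec N (neighbour_average g)"
proof (rule eq_vecI)
  fix i assume "i < dim_vec (vec N (neighbour_average g))"
  then have i: "i < N" by simp
  then have "(norm_adj_matrix N E *\<^sub>v vec N g) $ i = (\<Sum>j<N. (1 / d) * (if E i j then g j else 0))"
    by (auto simp: norm_adj_matrix_eq adj_matrix_def scalar_prod_def atLeast0LessThan
        intro!: sum.cong)
  then show "(norm_adj_matrix N E *\<^sub>v vec N g) $ i = vec N (neighbour_average g) $ i"
    using i
    by (simp add: neighbour_average_def sum_neighbours flip: sum_distrib_left sum_divide_distrib)
qed (simp add: norm_adj_matrix_eq adj_matrix_def)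

lemma neighbour_average_const: "i < N \<Longrightarrow> neighbour_average (\<lambda>_. c) i = c"
  using d_pos by (simp add: neighbour_average_def card_neighbours)

lemma sum_neighbour_average: "(\<Sum>i<N. neighbour_average g i) = (\<Sum>i<N. g i)"
proof -
  have "(\<Sum>i<N. neighbour_average g i) = (\<Sum>j<N. \<Sum>i<N. if E i j then g j else 0) / d"
    unfolding neighbour_average_def sum_neighbours sum_divide_distrib[symmetric]
    by (subst sum.swap) simp
  also have "\<dots> = (\<Sum>j<N. neighbour_average (\<lambda>_. g j) j)"
    unfolding neighbour_average_def sum_neighbours sum_divide_distrib by (simp only: E_commute)
  finally show ?thesis by (simp add: neighbour_average_const)
qed

definition edge_pairs :: "nat set \<Rightarrow> nat set \<Rightarrow> (nat \<times> nat) set" where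
  "edge_pairs X Y = {(x, y). x \<in> X \<and> y \<in> Y \<and> E x y}"

definition centred_indicator :: "nat set \<Rightarrow> nat \<Rightarrow> real" where
  "centred_indicator Z i = of_bool (i \<in> Z) - real (card Z) / real N"

lemma sum_of_bool_mem: "Z \<subseteq> {..<N} \<Longrightarrow> (\<Sum>i<N. of_bool (i \<in> Z)) = real (card Z)"
  by (simp add: sum_of_bool_eq Int_absorb1)

lemma sum_centred_indicator:
  assumes "Z \<subseteq> {..<N}"
  shows "(\<Sum>i<N. centred_indicator Z i) = 0"
proof (cases "N = 0")
  case False
  then show ?thesis by (simp add: centred_indicator_def sum_subtractf sum_of_bool_mem[OF assms])
qed simp

lemma sum_centred_indicator_mult:
  assumes Z: "Z \<subseteq> {..<N}" and h: "(\<Sum>i<N. h i) = 0"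
  shows "(\<Sum>i<N. centred_indicator Z i * h i) = (\<Sum>i\<in>Z. h i)"
proof -
  have "(\<Sum>i<N. centred_indicator Z i * h i)
      = (\<Sum>i<N. if i \<in> Z then h i else 0) - (card Z / N) * (\<Sum>i<N. h i)"
    unfolding centred_indicator_def sum_distrib_left sum_subtractf[symmetric]
    by (intro sum.cong) (auto simp: algebra_simps)
  then show ?thesis using Z h by (simp add: Int_absorb1 flip: sum.inter_restrict)
qed

lemma sum_centred_indicator_square:
  assumes Z: "Z \<subseteq> {..<N}"
  shows "(\<Sum>i<N. (centred_indicator Z i)\<^sup>2) = card Z * (1 - card Z / N)"
  using sum_centred_indicator_mult[OF Z sum_centred_indicator[OF Z]]
  by (simp add: power2_eq_square) (simp add: centred_indicator_def)

lemma sum_neighbour_average_centred_indicator: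
  assumes X: "X \<subseteq> {..<N}" and Y: "Y \<subseteq> {..<N}"
  shows "(\<Sum>i\<in>X. neighbour_average (centred_indicator Y) i)
    = real (card (edge_pairs X Y)) / d - real (card X) * real (card Y) / N"
proof -
  have fin: "finite X" "finite Y" using X Y finite_subset by auto
  have average:
    "neighbour_average (centred_indicator Y) i = real (card {y \<in> Y. E i y}) / d - card Y / N"
    if "i \<in> X" for i
  proof -
    have "{j. E i j} \<inter> Y = {y \<in> Y. E i y}" by auto
    then have "(\<Sum>j | E i j. centred_indicator Y j) = card {y \<in> Y. E i y} - d * (card Y / N)"
      using that X
      by (simp add: centred_indicator_def sum_subtractf sum_of_bool_eq finite_neighbours
          card_neighbours subset_iff)
    then show ?thesis using d_pos by (simp add: neighbour_average_def diff_divide_distrib)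
  qed
  have "edge_pairs X Y = Sigma X (\<lambda>i. {y \<in> Y. E i y})" by (auto simp: edge_pairs_def)
  then have "card (edge_pairs X Y) = (\<Sum>i\<in>X. card {y \<in> Y. E i y})" using fin by simp
  then show ?thesis by (simp add: average sum_subtractf sum_divide_distrib)
qed

end

locale regular_expander = regular_graph +
  fixes \<epsilon> :: real
  assumes N_ge_2: "2 \<le> N" and eps_pos: "0 < \<epsilon>" and eps_less_1: "\<epsilon> < 1"
    and expander: "spectral_expander N E \<epsilon>"
begin

lemma neighbour_average_contraction:
  assumes "(\<Sum>i<N. g i) = 0"
  shows "(\<Sum>i<N. (neighbour_average g i)\<^sup>2) \<le> \<epsilon>\<^sup>2 * (\<Sum>i<N. (g i)\<^sup>2)"
proof -
  let ?A = "norm_adj_matrix N E" and ?one = "vec N (\<lambda>_. 1 :: real)"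
  note A = norm_adj_matrix_symmetric
  have "(?A *\<^sub>v vec N g) \<bullet> (?A *\<^sub>v vec N g) \<le> \<epsilon>\<^sup>2 * (vec N g \<bullet> vec N g)"
  proof (rule symmetric_mat_contraction[OF A, where v = ?one and \<mu> = 1])
    show "?A *\<^sub>v ?one = 1 \<cdot>\<^sub>v ?one"
      unfolding norm_adj_matrix_mult_vec by (rule eq_vecI) (simp_all add: neighbour_average_const)
    show "?one \<noteq> 0\<^sub>v N" using N_ge_2 by (auto simp: vec_eq_iff intro!: exI[of _ 0])
    show "vec N g \<bullet> ?one = 0" using assms by (simp add: scalar_prod_def atLeast0LessThan)
    show "\<bar>eigenvalues_desc ?A ! i\<bar> \<le> \<epsilon>" if "0 < i" "i < N" for i
      using abs_eigenvalues_desc_le[OF A that] expander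
      unfolding spectral_expander_def sigma2_def Let_def by (rule order_trans)
  qed (use eps_less_1 in auto)
  then show ?thesis
    by (simp add: norm_adj_matrix_mult_vec scalar_prod_def atLeast0LessThan power2_eq_square)
qed

theorem expander_mixing:
  assumes X: "X \<subseteq> {..<N}" and Y: "Y \<subseteq> {..<N}"
  shows "(real (card (edge_pairs X Y)) / d - real (card X) * real (card Y) / N)\<^sup>2
    \<le> \<epsilon>\<^sup>2 * (card X * (1 - card X / N)) * (card Y * (1 - card Y / N))"
proof -
  let ?x = "centred_indicator X" and ?y = "centred_indicator Y"
  have "(\<Sum>i<N. neighbour_average ?y i) = 0"
    by (simp add: sum_neighbour_average sum_centred_indicator[OF Y])
  then have "real (card (edge_pairs X Y)) / d - real (card X) * real (card Y) / N
      = (\<Sum>i<N. ?x i * neighbour_average ?y i)"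
    by (simp add: sum_centred_indicator_mult[OF X] sum_neighbour_average_centred_indicator[OF X Y])
  also have "\<dots>\<^sup>2 \<le> (\<Sum>i<N. (?x i)\<^sup>2) * (\<Sum>i<N. (neighbour_average ?y i)\<^sup>2)"
    by (rule Cauchy_Schwarz_ineq_sum)
  also have "\<dots> \<le> (\<Sum>i<N. (?x i)\<^sup>2) * (\<epsilon>\<^sup>2 * (\<Sum>i<N. (?y i)\<^sup>2))"
    by (intro mult_left_mono neighbour_average_contraction sum_centred_indicator Y sum_nonneg) auto
  finally show ?thesis
    by (simp add: sum_centred_indicator_square[OF X] sum_centred_indicator_square[OF Y] mult_ac)
qed

lemma card_le_N: "X \<subseteq> {..<N} \<Longrightarrow> card X \<le> N"
  using card_mono[of "{..<N}" X] by simp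

lemma no_edges_bound:
  assumes X: "X \<subseteq> {..<N}" and Y: "Y \<subseteq> {..<N}" and none: "edge_pairs X Y = {}"
  shows "real (card X) * real (card Y) \<le> \<epsilon>\<^sup>2 * (real N - card X) * (real N - card Y)"
proof (cases "card X = 0 \<or> card Y = 0")
  case True
  then show ?thesis using card_le_N[OF X] card_le_N[OF Y] by auto
next
  case False
  let ?a = "real (card X)" and ?b = "real (card Y)" and ?m = "real N"
  have pos: "0 < ?a * ?b / ?m\<^sup>2" using False N_ge_2 by simp
  have "(?a * ?b / ?m\<^sup>2) * (?a * ?b) = (?a * ?b / ?m)\<^sup>2" by (simp add: power2_eq_square)
  also have "\<dots> \<le> \<epsilon>\<^sup>2 * (?a * (1 - ?a / ?m)) * (?b * (1 - ?b / ?m))"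
    using expander_mixing[OF X Y] none by simp
  also have "\<dots> = (?a * ?b / ?m\<^sup>2) * (\<epsilon>\<^sup>2 * (?m - ?a) * (?m - ?b))"
    using N_ge_2 by (simp add: field_simps power2_eq_square)
  finally show ?thesis using pos by (simp only: mult_le_cancel_left_pos)
qed

lemma eps_N_ge_1: "1 \<le> \<epsilon> * real N"
proof -
  have "edge_pairs {0} {0} = {}" using E_irrefl by (auto simp: edge_pairs_def)
  then have "1 \<le> (\<epsilon> * (real N - 1))\<^sup>2"
    using no_edges_bound[of "{0}" "{0}"] N_ge_2 by (simp add: power2_eq_square mult_ac)
  then have "1 \<le> \<epsilon> * (real N - 1)"
    using eps_pos N_ge_2 by (intro power2_le_imp_le[of 1]) auto
  also have "\<dots> \<le> \<epsilon> * real N" using eps_pos by simp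
  finally show ?thesis .
qed

lemma internal_edges_bound:
  assumes S: "S \<subseteq> {..<N}"
  shows "d * real (card S) * (card S / N - \<epsilon> * (1 - card S / N)) \<le> real (card (edge_pairs S S))"
proof -
  let ?s = "real (card S)" and ?e = "real (card (edge_pairs S S))"
  define K where "K = \<epsilon> * (?s * (1 - ?s / N))"
  have "0 \<le> K"
    unfolding K_def using card_le_N[OF S] eps_pos N_ge_2 by (intro mult_nonneg_nonneg) auto
  moreover have "(?e / d - ?s * ?s / N)\<^sup>2 \<le> K\<^sup>2"
    using expander_mixing[OF S S] by (simp add: K_def power2_eq_square mult_ac)
  then have "\<bar>?e / d - ?s * ?s / N\<bar> \<le> \<bar>K\<bar>" by (simp only: abs_le_square_iff)
  ultimately have "?s * ?s / N - K \<le> ?e / d" by linarith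
  then have "d * (?s * ?s / N - K) \<le> ?e"
    using d_pos by (simp add: pos_le_divide_eq mult.commute)
  then show ?thesis by (simp add: K_def algebra_simps)
qed

end

section \<open>Matchings and augmenting paths\<close>

fun paired_by :: "('a \<Rightarrow> 'a \<Rightarrow> bool) \<Rightarrow> 'a list \<Rightarrow> bool" where
  "paired_by R [] \<longleftrightarrow> True"
| "paired_by R [x] \<longleftrightarrow> False"
| "paired_by R (x # y # xs) \<longleftrightarrow> R x y \<and> paired_by R xs"

lemma paired_by_append: "even (length xs) \<Longrightarrow> paired_by R (xs @ ys) \<longleftrightarrow> paired_by R xs \<and> paired_by R ys"
  by (induction R xs rule: paired_by.induct) auto

lemma paired_by_even: "paired_by R xs \<Longrightarrow> even (length xs)"
  by (induction R xs rule: paired_by.induct) auto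

lemma paired_by_rev: "symp R \<Longrightarrow> paired_by R xs \<Longrightarrow> paired_by R (rev xs)"
  by (induction R xs rule: paired_by.induct)
     (auto simp: paired_by_append paired_by_even dest: sympD)

lemma paired_by_conj: "paired_by R xs \<Longrightarrow> paired_by S xs \<Longrightarrow> paired_by (\<lambda>x y. R x y \<and> S x y) xs"
  by (induction R xs rule: paired_by.induct) auto

lemma paired_by_mono_distinct:
  "paired_by R xs \<Longrightarrow> distinct xs \<Longrightarrow> (\<And>x y. R x y \<Longrightarrow> x \<noteq> y \<Longrightarrow> S x y) \<Longrightarrow> paired_by S xs"
  by (induction R xs rule: paired_by.induct) auto

lemma paired_by_partner:
  "paired_by R xs \<Longrightarrow> symp R \<Longrightarrow> v \<in> set xs \<Longrightarrow> \<exists>w\<in>set xs. R v w"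
  by (induction R xs rule: paired_by.induct) (auto dest: sympD)

definition swaps :: "('a \<Rightarrow> 'a) \<Rightarrow> 'a \<Rightarrow> 'a \<Rightarrow> bool" where
  "swaps f x y \<longleftrightarrow> f x = y \<and> f y = x"

lemma symp_swaps: "symp (swaps f)"
  by (auto simp: swaps_def intro: sympI)

lemma paired_by_swaps_closed: "paired_by (swaps f) xs \<Longrightarrow> v \<in> set xs \<Longrightarrow> f v \<in> set xs"
  using paired_by_partner[OF _ symp_swaps] by (fastforce simp: swaps_def)

lemma paired_by_swaps_not_fixed:
  "paired_by (swaps f) xs \<Longrightarrow> distinct xs \<Longrightarrow> v \<in> set xs \<Longrightarrow> f v \<noteq> v"
  by (induction "swaps f" xs rule: paired_by.induct) (auto simp: swaps_def)

lemma paired_by_swaps_unique: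
  "paired_by (swaps f) xs \<Longrightarrow> paired_by (swaps g) xs \<Longrightarrow> v \<in> set xs \<Longrightarrow> f v = g v"
  by (induction "swaps f" xs rule: paired_by.induct) (auto simp: swaps_def)

lemma paired_by_swaps_cong:
  "paired_by (swaps f) xs \<Longrightarrow> (\<And>v. v \<in> set xs \<Longrightarrow> g v = f v) \<Longrightarrow> paired_by (swaps g) xs"
  by (induction "swaps f" xs rule: paired_by.induct) (auto simp: swaps_def)

fun rematch :: "('a \<Rightarrow> 'a) \<Rightarrow> 'a list \<Rightarrow> 'a \<Rightarrow> 'a" where
  "rematch f (x # y # xs) = (rematch f xs)(x := y, y := x)"
| "rematch f _ = f"

lemma rematch_outside: "v \<notin> set xs \<Longrightarrow> rematch f xs v = f v"
  by (induction f xs rule: rematch.induct) auto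

lemma paired_by_swaps_rematch:
  "even (length xs) \<Longrightarrow> distinct xs \<Longrightarrow> paired_by (swaps (rematch f xs)) xs"
proof (induction f xs rule: rematch.induct)
  case (1 f x y xs)
  then have "paired_by (swaps (rematch f xs)) xs" by simp
  then have "paired_by (swaps (rematch f (x # y # xs))) xs"
    by (rule paired_by_swaps_cong) (use 1(3) in auto)
  moreover have "swaps (rematch f (x # y # xs)) x y" using 1(3) by (simp add: swaps_def)
  ultimately show ?case by (simp only: paired_by.simps)
qed auto

context regular_graph
begin

lemma symp_E: "symp E"
  using E_sym by (rule sympI)

lemma paired_by_E_subset: "paired_by E xs \<Longrightarrow> set xs \<subseteq> {..<N}"
  using paired_by_partner[OF _ symp_E] E_less by blast

definition unmatched :: "(nat \<Rightarrow> nat) \<Rightarrow> nat set" where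
  "unmatched f = {v. v < N \<and> f v = v}"

text \<open>A matching is encoded by the involution exchanging the endpoints of its edges.\<close>

definition matchings :: "nat \<Rightarrow> (nat \<Rightarrow> nat) set" where
  "matchings j = {f. (\<forall>v. f (f v) = v) \<and> (\<forall>v. f v \<noteq> v \<longrightarrow> E v (f v)) \<and> card (unmatched f) = 2 * j}"

lemma matchingsD:
  assumes "f \<in> matchings j"
  shows "f (f v) = v" and "f v \<noteq> v \<Longrightarrow> E v (f v)" and "card (unmatched f) = 2 * j"
    and "v < N \<Longrightarrow> f v < N" and "\<not> v < N \<Longrightarrow> f v = v" and "inj_on f S"
proof -
  show invol: "f (f v) = v" and edge: "f v \<noteq> v \<Longrightarrow> E v (f v)" and "card (unmatched f) = 2 * j" for v
    using assms by (auto simp: matchings_def)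
  show "v < N \<Longrightarrow> f v < N" using edge E_less(2) by metis
  show "\<not> v < N \<Longrightarrow> f v = v" using edge E_less(1) by metis
  show "inj_on f S" using invol by (intro inj_onI) metis
qed

lemma unmatched_subset: "unmatched f \<subseteq> {..<N}"
  by (auto simp: unmatched_def)

lemma finite_unmatched: "finite (unmatched f)"
  by (simp add: unmatched_def)

lemma finite_matchings: "finite (matchings j)"
proof (rule inj_on_finite)
  show "inj_on (\<lambda>f. map f [0..<N]) (matchings j)"
  proof (intro inj_onI ext)
    fix f g v assume fg: "f \<in> matchings j" "g \<in> matchings j" "map f [0..<N] = map g [0..<N]"
    then show "f v = g v"
      using matchingsD(5)[of f j v] matchingsD(5)[of g j v] by (cases "v < N") auto
  qed
  show "(\<lambda>f. map f [0..<N]) ` matchings j \<subseteq> {xs. set xs \<subseteq> {..<N} \<and> length xs = N}"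
    using matchingsD(4) by auto
qed (simp add: finite_lists_length_eq)

lemma id_in_matchings: "N = 2 * n \<Longrightarrow> id \<in> matchings n"
  unfolding matchings_def unmatched_def by simp

definition matched_edges :: "(nat \<Rightarrow> nat) \<Rightarrow> nat set set" where
  "matched_edges f = {{v, f v} | v. v < N}"

lemma perfect_matching_matched_edges:
  assumes f: "f \<in> matchings 0"
  shows "perfect_matching N E (matched_edges f)"
  unfolding perfect_matching_def
proof (intro conjI allI impI)
  show "matched_edges f \<subseteq> edges N E"
  proof
    fix e assume "e \<in> matched_edges f"
    then obtain v where v: "v < N" "e = {v, f v}" by (auto simp: matched_edges_def)
    have "unmatched f = {}" using matchingsD(3)[OF f] finite_unmatched by simp
    then have "E v (f v)" using v(1) by (intro matchingsD(2)[OF f]) (auto simp: unmatched_def)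
    then show "e \<in> edges N E" using v matchingsD(4)[OF f] by (auto simp: edges_def)
  qed
  fix v assume v: "v < N"
  show "\<exists>!e. e \<in> matched_edges f \<and> v \<in> e"
  proof (rule ex1I[of _ "{v, f v}"])
    show "{v, f v} \<in> matched_edges f \<and> v \<in> {v, f v}" using v by (auto simp: matched_edges_def)
    fix e assume "e \<in> matched_edges f \<and> v \<in> e"
    then obtain w where "e = {w, f w}" "v = w \<or> v = f w" by (auto simp: matched_edges_def)
    then show "e = {v, f v}" using matchingsD(1)[OF f, of w] by auto
  qed
qed

lemma inj_on_matched_edges: "inj_on matched_edges (matchings j)"
proof (intro inj_onI ext)
  fix f g v
  assume f: "f \<in> matchings j" and g: "g \<in> matchings j" and eq: "matched_edges f = matched_edges g"
  show "f v = g v"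
  proof (cases "v < N")
    case True
    then have "{v, f v} \<in> matched_edges g" unfolding eq[symmetric] by (auto simp: matched_edges_def)
    then obtain w where "{v, f v} = {w, g w}" by (auto simp: matched_edges_def)
    then show ?thesis using matchingsD(1)[OF g, of w] by (auto simp: doubleton_eq_iff)
  next
    case False
    then show ?thesis using matchingsD(5)[OF f] matchingsD(5)[OF g] by simp
  qed
qed

lemma card_matchings_0_le: "card (matchings 0) \<le> num_perfect_matchings N E"
  unfolding num_perfect_matchings_def
proof (rule card_inj_on_le[OF inj_on_matched_edges])
  show "matched_edges ` matchings 0 \<subseteq> {M. perfect_matching N E M}"
    using perfect_matching_matched_edges by auto
  have "{M. perfect_matching N E M} \<subseteq> Pow (Pow {..<N})"
    by (auto simp: perfect_matching_def edges_def)
  then show "finite {M. perfect_matching N E M}" by (rule finite_subset) simp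
qed

text \<open>A path is the list of its vertices: the pairs formed from its first vertex on are edges to be
  added, the pairs formed from its second vertex on are edges of the matching.\<close>

definition augmenting :: "(nat \<Rightarrow> nat) \<Rightarrow> nat \<Rightarrow> nat list set" where
  "augmenting f L = {u # I @ [v] | u I v. length I = 2 * L \<and> paired_by (swaps f) I
     \<and> paired_by E (u # I @ [v]) \<and> distinct (u # I @ [v]) \<and> f u = u \<and> f v = v}"

lemma augmentingE:
  assumes "P \<in> augmenting f L"
  obtains u I v where "P = u # I @ [v]" "length I = 2 * L" "paired_by (swaps f) I"
    "paired_by E P" "distinct P" "f u = u" "f v = v"
  using assms unfolding augmenting_def by blast

lemma finite_augmenting: "finite (augmenting f L)"
proof (rule finite_subset)
  show "augmenting f L \<subseteq> {xs. set xs \<subseteq> {..<N} \<and> length xs = 2 * L + 2}"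
    using paired_by_E_subset by (auto elim!: augmentingE)
qed (simp add: finite_lists_length_eq)

lemma rematch_along_edges:
  assumes "paired_by E P" "distinct P" "v \<in> set P"
  shows "rematch f P v \<in> set P" "rematch f P (rematch f P v) = v" "E v (rematch f P v)"
proof -
  let ?R = "\<lambda>x y. E x y \<and> swaps (rematch f P) x y"
  have "symp ?R" using E_sym by (auto intro!: sympI simp: swaps_def)
  moreover have "paired_by ?R P"
    using assms(1,2) by (intro paired_by_conj paired_by_swaps_rematch paired_by_even)
  ultimately obtain w where "w \<in> set P" "?R v w"
    using paired_by_partner[of ?R P v] assms(3) by blast
  then show "rematch f P v \<in> set P" "rematch f P (rematch f P v) = v" "E v (rematch f P v)"
    by (auto simp: swaps_def)
qed

lemma unmatched_rematch:
  assumes "P \<in> augmenting f L"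
  shows "unmatched (rematch f P) = unmatched f - {hd P, last P}"
proof -
  obtain u I v where P: "P = u # I @ [v]" and I: "paired_by (swaps f) I"
    and path: "paired_by E P" "distinct P"
    using assms by (rule augmentingE)
  have "w \<in> unmatched (rematch f P) \<longleftrightarrow> w \<in> unmatched f - {u, v}" for w
  proof (cases "w \<in> set P")
    case True
    then have "rematch f P w \<noteq> w" using rematch_along_edges(3)[OF path] E_irrefl by metis
    moreover have "f w \<noteq> w \<or> w \<in> {u, v}"
      using True P path(2) paired_by_swaps_not_fixed[OF I] by auto
    ultimately show ?thesis by (auto simp: unmatched_def)
  next
    case False
    then show ?thesis using P by (auto simp: unmatched_def rematch_outside)
  qed
  then show ?thesis using P by auto
qed

lemma rematch_in_matchings:
  assumes f: "f \<in> matchings (Suc j)" and "P \<in> augmenting f L"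
  shows "rematch f P \<in> matchings j"
proof -
  obtain u I v where P: "P = u # I @ [v]" and I: "paired_by (swaps f) I"
    and path: "paired_by E P" "distinct P" and ends: "f u = u" "f v = v"
    using assms(2) by (rule augmentingE)
  let ?g = "rematch f P"
  have "?g (?g w) = w" for w
  proof (cases "w \<in> set P")
    case True
    then show ?thesis by (rule rematch_along_edges(2)[OF path])
  next
    case False
    have "f x \<in> set P" if "x \<in> set P" for x
      using that P ends paired_by_swaps_closed[OF I] by auto
    then have "f w \<notin> set P" using False matchingsD(1)[OF f] by metis
    then show ?thesis using False matchingsD(1)[OF f] by (simp add: rematch_outside)
  qed
  moreover have "E w (?g w)" if "?g w \<noteq> w" for w
    using that rematch_along_edges(3)[OF path] matchingsD(2)[OF f]
    by (cases "w \<in> set P") (auto simp: rematch_outside)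
  moreover have "card (unmatched ?g) = 2 * j"
  proof -
    have "{u, v} \<subseteq> unmatched f"
      using P ends paired_by_E_subset[OF path(1)] by (auto simp: unmatched_def)
    then show ?thesis
      using unmatched_rematch[OF assms(2)] matchingsD(3)[OF f] P path(2)
      by (simp add: card_Diff_subset)
  qed
  ultimately show ?thesis by (simp add: matchings_def)
qed

lemma rematch_cancel:
  assumes f: "P \<in> augmenting f L" and g: "P \<in> augmenting g L" and eq: "rematch f P = rematch g P"
  shows "f = g"
proof
  fix w
  obtain u I v where P: "P = u # I @ [v]" and I: "paired_by (swaps f) I"
    and fuv: "f u = u" "f v = v"
    using f by (rule augmentingE)
  from g P have J: "paired_by (swaps g) I" and guv: "g u = u" "g v = v"
    by (auto elim!: augmentingE)
  show "f w = g w"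
  proof (cases "w \<in> set P")
    case True
    then show ?thesis using P fuv guv paired_by_swaps_unique[OF I J] by auto
  next
    case False
    then show ?thesis using eq rematch_outside[of w P f] rematch_outside[of w P g] by simp
  qed
qed

fun alternating_walks :: "(nat \<Rightarrow> nat) \<Rightarrow> nat \<Rightarrow> nat \<Rightarrow> nat list set" where
  "alternating_walks g 0 x = {[x, g x]}"
| "alternating_walks g (Suc L) x =
     (\<Union>y\<in>{y. E (g x) y}. (\<lambda>xs. x # g x # xs) ` alternating_walks g L y)"

lemma finite_alternating_walks: "finite (alternating_walks g L x)"
  by (induction g L x rule: alternating_walks.induct) (auto simp: finite_neighbours)

lemma card_alternating_walks: "card (alternating_walks g L x) \<le> d ^ L"
proof (induction g L x rule: alternating_walks.induct)
  case (2 g L x)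
  have "card (alternating_walks g (Suc L) x)
      \<le> (\<Sum>y\<in>{y. E (g x) y}. card ((\<lambda>xs. x # g x # xs) ` alternating_walks g L y))"
    by (simp add: card_UN_le finite_neighbours)
  also have "\<dots> \<le> (\<Sum>y\<in>{y. E (g x) y}. d ^ L)"
    using 2 by (intro sum_mono order_trans[OF card_image_le]) (auto simp: finite_alternating_walks)
  also have "\<dots> \<le> d * d ^ L" using card_neighbours_le by simp
  finally show ?case by simp
qed auto

lemma in_alternating_walks:
  "paired_by (swaps g) (u # I @ [v]) \<Longrightarrow> paired_by E I \<Longrightarrow> length I = 2 * L
    \<Longrightarrow> u # I @ [v] \<in> alternating_walks g L u"
proof (induction L arbitrary: u I)
  case (Suc L)
  then obtain a b J where I: "I = a # b # J" "length J = 2 * L"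
    by (auto simp: length_Suc_conv)
  with Suc have "b # J @ [v] \<in> alternating_walks g L b" by (auto simp: swaps_def)
  then show ?case using Suc.prems I by (auto simp: swaps_def)
qed (auto simp: swaps_def)

definition matched_walks :: "(nat \<Rightarrow> nat) \<Rightarrow> nat \<Rightarrow> nat list set" where
  "matched_walks g L = (\<Union>u\<in>{..<N} - unmatched g. alternating_walks g L u)"

lemma finite_matched_walks: "finite (matched_walks g L)"
  by (simp add: matched_walks_def finite_alternating_walks)

lemma card_matched_walks:
  assumes "g \<in> matchings j"
  shows "card (matched_walks g L) \<le> (N - 2 * j) * d ^ L"
proof -
  have "card (matched_walks g L) \<le> (\<Sum>u\<in>{..<N} - unmatched g. card (alternating_walks g L u))"
    unfolding matched_walks_def by (intro card_UN_le) simp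
  also have "\<dots> \<le> (\<Sum>u\<in>{..<N} - unmatched g. d ^ L)"
    by (intro sum_mono card_alternating_walks)
  also have "\<dots> = (N - 2 * j) * d ^ L"
    using matchingsD(3)[OF assms] by (simp add: card_Diff_subset finite_unmatched unmatched_subset)
  finally show ?thesis .
qed

lemma augmenting_in_matched_walks:
  assumes f: "f \<in> matchings j" and "P \<in> augmenting f L"
  shows "P \<in> matched_walks (rematch f P) L"
proof -
  obtain u I v where P: "P = u # I @ [v]" "length I = 2 * L" and I: "paired_by (swaps f) I"
    and path: "paired_by E P" "distinct P"
    using assms(2) by (rule augmentingE)
  have "paired_by E I"
    by (rule paired_by_mono_distinct[OF I])
       (use P path(2) matchingsD(2)[OF f] in \<open>auto simp: swaps_def\<close>)
  then have "P \<in> alternating_walks (rematch f P) L u"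
    using in_alternating_walks[of "rematch f P" u I v L] P
      paired_by_swaps_rematch[OF paired_by_even[OF path(1)] path(2), of f] by simp
  moreover have "E u (rematch f P u)" using P(1) by (intro rematch_along_edges(3)[OF path]) simp
  then have "u \<in> {..<N} - unmatched (rematch f P)"
    using E_less(1) E_irrefl by (auto simp: unmatched_def)
  ultimately show ?thesis unfolding matched_walks_def by blast
qed

lemma sum_card_augmenting_le:
  "(\<Sum>f\<in>matchings (Suc j). card (augmenting f L)) \<le> card (matchings j) * ((N - 2 * j) * d ^ L)"
proof -
  let ?A = "Sigma (matchings (Suc j)) (\<lambda>f. augmenting f L)"
  let ?B = "Sigma (matchings j) (\<lambda>g. matched_walks g L)"
  have "card ?A \<le> card ?B"
  proof (rule card_inj_on_le)
    show "inj_on (\<lambda>(f, P). (rematch f P, P)) ?A"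
      by (rule inj_onI) (use rematch_cancel in auto)
    show "(\<lambda>(f, P). (rematch f P, P)) ` ?A \<subseteq> ?B"
      using rematch_in_matchings augmenting_in_matched_walks by auto
    show "finite ?B" by (intro finite_SigmaI finite_matchings finite_matched_walks)
  qed
  also have "card ?B = (\<Sum>g\<in>matchings j. card (matched_walks g L))"
    by (simp add: card_SigmaI finite_matchings finite_matched_walks)
  also have "\<dots> \<le> (\<Sum>g\<in>matchings j. (N - 2 * j) * d ^ L)"
    by (intro sum_mono card_matched_walks)
  finally show ?thesis by (simp add: card_SigmaI finite_matchings finite_augmenting)
qed

lemma card_matchings_Suc_le:
  fixes c :: real
  assumes many: "\<And>f. f \<in> matchings (Suc j) \<Longrightarrow> c \<le> real (card (augmenting f L))"
    and j: "2 * j \<le> N"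
  shows "card (matchings (Suc j)) * c \<le> card (matchings j) * ((real N - 2 * real j) * real d ^ L)"
proof -
  have "card (matchings (Suc j)) * c \<le> (\<Sum>f\<in>matchings (Suc j). real (card (augmenting f L)))"
    using sum_mono[of "matchings (Suc j)" "\<lambda>_. c"] many by simp
  also have "\<dots> \<le> real (card (matchings j) * ((N - 2 * j) * d ^ L))"
    using sum_card_augmenting_le[of L j] by (simp only: of_nat_sum[symmetric] of_nat_le_iff)
  finally show ?thesis using j by (simp add: of_nat_diff)
qed

lemma card_edge_pairs_unmatched_le:
  "card (edge_pairs (unmatched f) (unmatched f)) \<le> card (augmenting f 0)"
proof (rule card_inj_on_le[of "\<lambda>(u, v). [u, v]"])
  show "inj_on (\<lambda>(u, v). [u, v]) (edge_pairs (unmatched f) (unmatched f))" by (auto intro!: inj_onI)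
  show "(\<lambda>(u, v). [u, v]) ` edge_pairs (unmatched f) (unmatched f) \<subseteq> augmenting f 0"
    using E_irrefl by (auto simp: edge_pairs_def augmenting_def unmatched_def)
qed (rule finite_augmenting)

end

section \<open>Short augmenting paths in expanders\<close>

context regular_graph
begin

definition reaches :: "(nat \<Rightarrow> nat) \<Rightarrow> nat set \<Rightarrow> nat \<Rightarrow> nat \<Rightarrow> bool" where
  "reaches f V t x \<longleftrightarrow> (\<exists>u I Q. u # I = Q @ [x] \<and> length I = 2 * t \<and> paired_by (swaps f) I
     \<and> paired_by E Q \<and> distinct (u # I) \<and> set (u # I) \<subseteq> V \<and> f u = u)"

lemma reachesE:
  assumes "reaches f V t x"
  obtains u I Q where "u # I = Q @ [x]" "length I = 2 * t" "paired_by (swaps f) I" "paired_by E Q"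
    "distinct (u # I)" "set (u # I) \<subseteq> V" "f u = u"
  using assms unfolding reaches_def by blast

lemma reaches_root: "f x = x \<Longrightarrow> x \<in> V \<Longrightarrow> reaches f V 0 x"
  unfolding reaches_def by (intro exI[of _ x] exI[of _ "[]"]) auto

lemma reaches_step:
  assumes "reaches f V t x" and a: "E x a" "a \<notin> V" "f a \<notin> V" "f a \<noteq> a" "f (f a) = a"
    and V': "V \<subseteq> V'" "a \<in> V'" "f a \<in> V'"
  shows "reaches f V' (Suc t) (f a)"
proof -
  obtain u I Q where path: "u # I = Q @ [x]" "length I = 2 * t" "paired_by (swaps f) I"
      "paired_by E Q" "distinct (u # I)" "set (u # I) \<subseteq> V" "f u = u"
    using assms(1) by (rule reachesE)
  show ?thesis unfolding reaches_def
  proof (intro exI conjI)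
    show "u # (I @ [a, f a]) = (Q @ [x, a]) @ [f a]" using path(1) by simp
    show "paired_by (swaps f) (I @ [a, f a])"
      using path(2,3) a(5) by (simp add: paired_by_append swaps_def)
    show "paired_by E (Q @ [x, a])"
      using path(4) a(1) by (simp add: paired_by_append paired_by_even)
    show "distinct (u # (I @ [a, f a]))" using path(5,6) a by auto
    show "set (u # (I @ [a, f a])) \<subseteq> V'" using path(6) V' by auto
  qed (use path in auto)
qed

lemma reaches_join:
  assumes reach1: "reaches f V1 t x1" and reach2: "reaches f V2 t x2" and V: "V1 \<inter> V2 = {}"
    and a: "E x1 a" "E x2 (f a)" "a \<notin> V1 \<union> V2" "f a \<notin> V1 \<union> V2" "f a \<noteq> a" "f (f a) = a"
  shows "\<exists>P\<in>augmenting f (2 * t + 1). P ! (2 * t + 1) = a"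
proof -
  obtain u1 I1 Q1 where path1: "u1 # I1 = Q1 @ [x1]" "length I1 = 2 * t" "paired_by (swaps f) I1"
      "paired_by E Q1" "distinct (u1 # I1)" "set (u1 # I1) \<subseteq> V1" "f u1 = u1"
    using reach1 by (rule reachesE)
  obtain u2 I2 Q2 where path2: "u2 # I2 = Q2 @ [x2]" "length I2 = 2 * t" "paired_by (swaps f) I2"
      "paired_by E Q2" "distinct (u2 # I2)" "set (u2 # I2) \<subseteq> V2" "f u2 = u2"
    using reach2 by (rule reachesE)
  define I where "I = I1 @ [a, f a] @ rev I2"
  define P where "P = u1 # I @ [u2]"
  have P_by_matching: "P = (u1 # I1) @ [a, f a] @ rev (u2 # I2)" by (simp add: P_def I_def)
  have P_by_edges: "P = Q1 @ [x1, a] @ [f a, x2] @ rev Q2"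
    unfolding P_by_matching path1(1) path2(1) by simp
  have "paired_by E P"
    unfolding P_by_edges using path1(4) path2(4) a(1,2) E_sym
    by (simp add: paired_by_append paired_by_even paired_by_rev[OF symp_E])
  moreover have "distinct P"
    unfolding P_by_matching using path1(5,6) path2(5,6) V a by auto
  moreover have "paired_by (swaps f) I"
    unfolding I_def using path1(2,3) path2(3) a(6)
    by (simp add: paired_by_append paired_by_rev[OF symp_swaps] swaps_def)
  moreover have "length I = 2 * (2 * t + 1)" using path1(2) path2(2) by (simp add: I_def)
  ultimately have "P \<in> augmenting f (2 * t + 1)"
    unfolding augmenting_def using P_def path1(7) path2(7) by blast
  moreover have "P ! (2 * t + 1) = a"
    using path1(2) by (simp add: P_def I_def nth_append)
  ultimately show ?thesis by blast
qed

text \<open>The factor \<open>4\<close> survives the doubling of \<open>s\<close>: a step adds \<open>2 s\<close> vertices and their partners.\<close>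

definition alternating_forest :: "(nat \<Rightarrow> nat) \<Rightarrow> nat \<Rightarrow> nat \<Rightarrow> nat set \<Rightarrow> nat set \<Rightarrow> bool" where
  "alternating_forest f t s X V \<longleftrightarrow> X \<subseteq> V \<and> V \<subseteq> {..<N} \<and> f ` V \<subseteq> V
     \<and> (\<forall>x\<in>X. reaches f V t x) \<and> card X = s \<and> card V \<le> 4 * s"

lemma alternating_forestD:
  assumes "alternating_forest f t s X V"
  shows "X \<subseteq> V" "V \<subseteq> {..<N}" "f ` V \<subseteq> V" "\<And>x. x \<in> X \<Longrightarrow> reaches f V t x"
    "card X = s" "card V \<le> 4 * s"
  using assms unfolding alternating_forest_def by blast+

lemma alternating_forest_step:
  assumes f: "f \<in> matchings j" and forest: "alternating_forest f t s X V"
    and D: "D \<subseteq> {..<N} - V" "card D = 2 * s"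
    and adjacent: "\<And>a. a \<in> D \<Longrightarrow> \<exists>x\<in>X. E x a" and moved: "\<And>a. a \<in> D \<Longrightarrow> f a \<noteq> a"
  shows "alternating_forest f (Suc t) (2 * s) (f ` D) (V \<union> (D \<union> f ` D))"
  unfolding alternating_forest_def
proof (intro conjI ballI)
  note forestD = alternating_forestD[OF forest] and invol = matchingsD(1)[OF f]
  show "V \<union> (D \<union> f ` D) \<subseteq> {..<N}" using forestD(2) D(1) matchingsD(4)[OF f] by auto
  show "f ` (V \<union> (D \<union> f ` D)) \<subseteq> V \<union> (D \<union> f ` D)" using forestD(3) invol by auto
  show "card (f ` D) = 2 * s" using D(2) by (simp add: card_image matchingsD(6)[OF f])
  then show "card (V \<union> (D \<union> f ` D)) \<le> 4 * (2 * s)"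
    using forestD(6) D(2) card_Un_le[of V "D \<union> f ` D"] card_Un_le[of D "f ` D"] by simp
  fix y assume "y \<in> f ` D"
  then obtain a where a: "a \<in> D" "y = f a" by blast
  obtain x where x: "x \<in> X" "E x a" using adjacent[OF a(1)] by blast
  have "a \<notin> V" using a(1) D(1) by blast
  moreover from this have "f a \<notin> V" using forestD(3) invol by (metis image_subset_iff)
  ultimately show "reaches f (V \<union> (D \<union> f ` D)) (Suc t) y"
    unfolding a(2) using a(1) by (intro reaches_step[OF forestD(4)[OF x(1)] x(2)] moved invol) auto
qed auto

text \<open>Because the two forests are disjoint and closed under the matching, joining a path of the
  first to a path of the second never creates a blossom.\<close>

definition disjoint_forests ::
  "(nat \<Rightarrow> nat) \<Rightarrow> nat \<Rightarrow> nat \<Rightarrow> nat set \<Rightarrow> nat set \<Rightarrow> nat set \<Rightarrow> nat set \<Rightarrow> bool" where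
  "disjoint_forests f t s X1 V1 X2 V2 \<longleftrightarrow>
     alternating_forest f t s X1 V1 \<and> alternating_forest f t s X2 V2
     \<and> V1 \<inter> V2 = {} \<and> unmatched f \<subseteq> V1 \<union> V2"

lemma disjoint_forestsD:
  assumes "disjoint_forests f t s X1 V1 X2 V2"
  shows "alternating_forest f t s X1 V1" "alternating_forest f t s X2 V2" "V1 \<inter> V2 = {}"
    "unmatched f \<subseteq> V1 \<union> V2"
  using assms unfolding disjoint_forests_def by blast+

lemma outside_forests:
  assumes f: "f \<in> matchings j" and forests: "disjoint_forests f t s X1 V1 X2 V2"
    and a: "a \<in> {..<N} - (V1 \<union> V2)"
  shows "f a \<in> {..<N} - (V1 \<union> V2)" "f a \<noteq> a"
proof -
  note forestsD = disjoint_forestsD[OF forests]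
  show "f a \<noteq> a" using a forestsD(4) by (auto simp: unmatched_def)
  have "f a \<notin> V1 \<union> V2"
    using a alternating_forestD(3)[OF forestsD(1)] alternating_forestD(3)[OF forestsD(2)]
      matchingsD(1)[OF f, of a]
    by (metis DiffD2 UnCI UnE image_subset_iff)
  then show "f a \<in> {..<N} - (V1 \<union> V2)" using a matchingsD(4)[OF f] by auto
qed

lemma card_outside_forests:
  assumes "disjoint_forests f t s X1 V1 X2 V2"
  shows "real N - 8 * real s \<le> real (card ({..<N} - (V1 \<union> V2)))"
proof -
  note forestsD = disjoint_forestsD(1,2)[OF assms]
  have "card (V1 \<union> V2) \<le> 8 * s"
    using card_Un_le[of V1 V2]
      alternating_forestD(6)[OF forestsD(1)] alternating_forestD(6)[OF forestsD(2)]
    by simp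
  moreover have "card ({..<N} - (V1 \<union> V2)) = N - card (V1 \<union> V2)"
    using alternating_forestD(2)[OF forestsD(1)] alternating_forestD(2)[OF forestsD(2)]
    by (subst card_Diff_subset) (auto intro: finite_subset)
  ultimately show ?thesis by linarith
qed

lemma disjoint_forests_start:
  assumes f: "f \<in> matchings j"
  shows "\<exists>X1 V1 X2 V2. disjoint_forests f 0 j X1 V1 X2 V2"
proof -
  have card_unmatched: "card (unmatched f) = 2 * j" by (rule matchingsD(3)[OF f])
  then obtain U where U: "U \<subseteq> unmatched f" "card U = j"
    using obtain_subset_with_card_n[of j "unmatched f"] by auto
  have "card (unmatched f - U) = j"
    using U card_unmatched finite_subset[OF U(1) finite_unmatched] by (simp add: card_Diff_subset)
  then have "disjoint_forests f 0 j U U (unmatched f - U) (unmatched f - U)"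
    using U
    by (auto simp: disjoint_forests_def alternating_forest_def unmatched_def intro!: reaches_root)
  then show ?thesis by blast
qed

lemma obtain_disjoint_matched_sets:
  assumes f: "f \<in> matchings j" and A: "k \<le> card A1" "3 * k \<le> card A2"
  obtains D1 D2 where "D1 \<subseteq> A1" "D2 \<subseteq> A2" "card D1 = k" "card D2 = k"
    "(D1 \<union> f ` D1) \<inter> (D2 \<union> f ` D2) = {}"
proof -
  obtain D1 where D1: "D1 \<subseteq> A1" "card D1 = k" "finite D1"
    using obtain_subset_with_card_n[OF A(1)] .
  have "card (D1 \<union> f ` D1) \<le> 2 * k"
    using card_Un_le[of D1 "f ` D1"] D1(2) by (simp add: card_image matchingsD(6)[OF f])
  then have "k \<le> card (A2 - (D1 \<union> f ` D1))"
    using diff_card_le_card_Diff[of "D1 \<union> f ` D1" A2] D1(3) A(2) by simp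
  then obtain D2 where D2: "D2 \<subseteq> A2 - (D1 \<union> f ` D1)" "card D2 = k"
    by (rule obtain_subset_with_card_n)
  have "f b \<notin> D1 \<union> f ` D1" if "b \<in> D2" for b
  proof
    assume "f b \<in> D1 \<union> f ` D1"
    then obtain a where a: "a \<in> D1" "f b = a \<or> f b = f a" by blast
    then have "b = f a \<or> b = a" using matchingsD(1)[OF f] by metis
    then show False using a(1) that D2(1) by blast
  qed
  then have "f ` D2 \<inter> (D1 \<union> f ` D1) = {}" by blast
  then have "(D1 \<union> f ` D1) \<inter> (D2 \<union> f ` D2) = {}" using D2(1) by blast
  moreover have "D2 \<subseteq> A2" using D2(1) by blast
  ultimately show thesis using that D1(1,2) D2(2) by blast
qed

lemma disjoint_forests_step:
  assumes f: "f \<in> matchings j" and forests: "disjoint_forests f t s X1 V1 X2 V2"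
  defines "W \<equiv> {..<N} - (V1 \<union> V2)"
  assumes many: "6 * s \<le> card {a \<in> W. \<exists>x\<in>X1. E x a}" "6 * s \<le> card {a \<in> W. \<exists>x\<in>X2. E x a}"
  shows "\<exists>X1 V1 X2 V2. disjoint_forests f (Suc t) (2 * s) X1 V1 X2 V2"
proof -
  note forestsD = disjoint_forestsD[OF forests]
  have outside: "f a \<in> W" "f a \<noteq> a" if "a \<in> W" for a
    using outside_forests[OF f forests] that unfolding W_def by auto
  have "2 * s \<le> card {a \<in> W. \<exists>x\<in>X1. E x a}" "3 * (2 * s) \<le> card {a \<in> W. \<exists>x\<in>X2. E x a}"
    using many by auto
  then obtain D1 D2 where D: "D1 \<subseteq> {a \<in> W. \<exists>x\<in>X1. E x a}" "D2 \<subseteq> {a \<in> W. \<exists>x\<in>X2. E x a}"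
      "card D1 = 2 * s" "card D2 = 2 * s" and disj: "(D1 \<union> f ` D1) \<inter> (D2 \<union> f ` D2) = {}"
    by (rule obtain_disjoint_matched_sets[OF f])
  have W_outside: "W \<subseteq> {..<N} - V1" "W \<subseteq> {..<N} - V2" "W \<inter> (V1 \<union> V2) = {}" by (auto simp: W_def)
  have D_in_W: "D1 \<union> f ` D1 \<subseteq> W" "D2 \<union> f ` D2 \<subseteq> W"
    using D(1,2) outside by auto
  have "alternating_forest f (Suc t) (2 * s) (f ` D1) (V1 \<union> (D1 \<union> f ` D1))"
    using D(1,3) D_in_W(1) W_outside(1) outside(2)
    by (intro alternating_forest_step[OF f forestsD(1)]) auto
  moreover have "alternating_forest f (Suc t) (2 * s) (f ` D2) (V2 \<union> (D2 \<union> f ` D2))"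
    using D(2,4) D_in_W(2) W_outside(2) outside(2)
    by (intro alternating_forest_step[OF f forestsD(2)]) auto
  moreover have "(V1 \<union> (D1 \<union> f ` D1)) \<inter> (V2 \<union> (D2 \<union> f ` D2)) = {}"
  proof -
    have "(V1 \<union> A1) \<inter> (V2 \<union> A2) = {}" if "A1 \<subseteq> W" "A2 \<subseteq> W" "A1 \<inter> A2 = {}" for A1 A2
      using that W_outside(3) forestsD(3) by blast
    then show ?thesis using D_in_W disj .
  qed
  ultimately show ?thesis using forestsD(4) unfolding disjoint_forests_def by blast
qed

definition joining_vertices :: "(nat \<Rightarrow> nat) \<Rightarrow> nat set \<Rightarrow> nat set \<Rightarrow> nat set \<Rightarrow> nat set" where
  "joining_vertices f X1 X2 W = {a \<in> W. (\<exists>x\<in>X1. E x a) \<and> (\<exists>x\<in>X2. E x (f a))}"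

lemma card_joining_vertices_le:
  assumes f: "f \<in> matchings j" and forests: "disjoint_forests f t s X1 V1 X2 V2"
  shows "card (joining_vertices f X1 X2 ({..<N} - (V1 \<union> V2))) \<le> card (augmenting f (2 * t + 1))"
proof -
  let ?J = "joining_vertices f X1 X2 ({..<N} - (V1 \<union> V2))"
  note forestsD = disjoint_forestsD[OF forests]
  have "\<exists>P\<in>augmenting f (2 * t + 1). P ! (2 * t + 1) = a" if joining: "a \<in> ?J" for a
  proof -
    obtain x1 x2 where x: "x1 \<in> X1" "E x1 a" "x2 \<in> X2" "E x2 (f a)" and a: "a \<in> {..<N} - (V1 \<union> V2)"
      using joining unfolding joining_vertices_def by blast
    show ?thesis
      using a outside_forests[OF f forests a] matchingsD(1)[OF f, of a]
      by (intro reaches_join[OF alternating_forestD(4)[OF forestsD(1) x(1)]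
            alternating_forestD(4)[OF forestsD(2) x(3)] forestsD(3) x(2,4)]) auto
  qed
  then obtain p where p: "\<And>a. a \<in> ?J \<Longrightarrow> p a \<in> augmenting f (2 * t + 1) \<and> p a ! (2 * t + 1) = a"
    by metis
  then have "inj_on p ?J" by (metis inj_onI)
  then show ?thesis
    using p by (intro card_inj_on_le[of p]) (auto simp: finite_augmenting)
qed

definition non_neighbours :: "nat set \<Rightarrow> nat set \<Rightarrow> nat set" where
  "non_neighbours X W = {a \<in> W. \<not> (\<exists>x\<in>X. E x a)}"

lemma card_minus_non_neighbours_le:
  assumes f: "f \<in> matchings j" and W: "finite W" "f ` W \<subseteq> W"
  shows "card W - card (non_neighbours X1 W) - card (non_neighbours X2 W)
    \<le> card (joining_vertices f X1 X2 W)"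
proof -
  let ?Y1 = "non_neighbours X1 W" and ?Y2 = "non_neighbours X2 W"
    and ?J = "joining_vertices f X1 X2 W"
  have fin: "finite ?Y1" "finite ?Y2" "finite ?J"
    using W(1) by (auto simp: non_neighbours_def joining_vertices_def)
  have "a \<in> ?Y1 \<union> f ` ?Y2 \<union> ?J" if "a \<in> W" for a
  proof (cases "f a \<in> ?Y2")
    case True
    then show ?thesis using matchingsD(1)[OF f] by (metis UnCI image_eqI)
  qed (use that W(2) in \<open>auto simp: non_neighbours_def joining_vertices_def\<close>)
  then have "card W \<le> card (?Y1 \<union> f ` ?Y2 \<union> ?J)" using fin by (intro card_mono) auto
  also have "\<dots> \<le> card ?Y1 + card (f ` ?Y2) + card ?J"
    using card_Un_le[of "?Y1 \<union> f ` ?Y2" ?J] card_Un_le[of ?Y1 "f ` ?Y2"] by linarith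
  also have "card (f ` ?Y2) = card ?Y2" by (simp add: card_image matchingsD(6)[OF f])
  finally show ?thesis by linarith
qed

end

context regular_expander
begin

lemma card_non_neighbours_bound:
  assumes X: "X \<subseteq> {..<N}" and W: "W \<subseteq> {..<N}"
  shows "real (card X) * card (non_neighbours X W)
    \<le> \<epsilon>\<^sup>2 * (real N * (real N - card (non_neighbours X W)))"
proof -
  let ?Y = "non_neighbours X W"
  have Y: "?Y \<subseteq> {..<N}" using W by (auto simp: non_neighbours_def)
  have "edge_pairs X ?Y = {}" by (auto simp: edge_pairs_def non_neighbours_def)
  then have "real (card X) * card ?Y \<le> \<epsilon>\<^sup>2 * ((real N - card X) * (real N - card ?Y))"
    using no_edges_bound[OF X Y] by (simp add: mult.assoc)
  also have "\<dots> \<le> \<epsilon>\<^sup>2 * (real N * (real N - card ?Y))"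
    using card_le_N[OF Y] by (intro mult_left_mono mult_right_mono) auto
  finally show ?thesis .
qed

lemma card_non_neighbours_le:
  assumes "X \<subseteq> {..<N}" "W \<subseteq> {..<N}"
  shows "real (card X) * card (non_neighbours X W) \<le> (\<epsilon> * real N)\<^sup>2"
proof -
  have "\<epsilon>\<^sup>2 * (real N * (real N - card (non_neighbours X W))) \<le> \<epsilon>\<^sup>2 * (real N * real N)"
    by (intro mult_left_mono) auto
  then show ?thesis
    using card_non_neighbours_bound[OF assms] by (simp add: power2_eq_square mult_ac)
qed

end

locale strong_expander = regular_expander +
  fixes n :: nat
  assumes N_eq: "N = 2 * n" and eps_le: "\<epsilon> \<le> 1 / 11"
begin

lemma n_pos: "0 < n"
  using N_ge_2 N_eq by simp

lemma real_N: "real N = 2 * real n"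
  by (simp add: N_eq)

lemma eps_mult_le: "0 \<le> x \<Longrightarrow> \<epsilon> * x \<le> x / 11"
  using mult_right_mono[OF eps_le, of x] by simp

lemma card_new_neighbours_ge:
  assumes X: "X \<subseteq> {..<N}" and s: "1 \<le> card X" "4 * real (card X) \<le> \<epsilon> * real N"
    and W: "W \<subseteq> {..<N}" "real N - 8 * real (card X) \<le> card W"
  shows "6 * card X \<le> card {a \<in> W. \<exists>x\<in>X. E x a}"
proof (rule ccontr)
  let ?A = "{a \<in> W. \<exists>x\<in>X. E x a}" and ?s = "real (card X)"
    and ?y = "real (card (non_neighbours X W))"
  assume "\<not> ?thesis"
  then have few: "real (card ?A) \<le> 6 * ?s" by simp
  have "finite W" using W(1) finite_subset by auto
  then have "card W = card ?A + card (non_neighbours X W)"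
    unfolding non_neighbours_def
    by (subst card_Un_disjoint[symmetric]) (auto intro: arg_cong[of _ _ card])
  then have y_ge: "N - 14 * ?s \<le> ?y" using W(2) few by simp
  have "?s * ?y \<le> \<epsilon>\<^sup>2 * (N * (N - ?y))" by (rule card_non_neighbours_bound[OF X W(1)])
  also have "\<dots> \<le> \<epsilon>\<^sup>2 * (N * (14 * ?s))" using y_ge by (intro mult_left_mono) auto
  also have "\<dots> = ?s * (14 * (\<epsilon> * (\<epsilon> * N)))" by (simp add: power2_eq_square)
  finally have "?y \<le> 14 * (\<epsilon> * (\<epsilon> * N))" using s(1) by (simp only: mult_le_cancel_left_pos)
  moreover have "\<epsilon> * (\<epsilon> * N) \<le> \<epsilon> * N / 11" using eps_pos by (intro eps_mult_le) simp
  moreover have "\<epsilon> * N \<le> N / 11" by (intro eps_mult_le) simp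
  ultimately show False using y_ge s(2) N_ge_2 by linarith
qed

lemma disjoint_forests_exist:
  assumes f: "f \<in> matchings j" and j: "1 \<le> j" and "real (2 ^ t * j) \<le> \<epsilon> * real n"
  shows "\<exists>X1 V1 X2 V2. disjoint_forests f t (2 ^ t * j) X1 V1 X2 V2"
  using assms(3)
proof (induction t)
  case 0
  then show ?case using disjoint_forests_start[OF f] by simp
next
  case (Suc t)
  define s where "s = 2 ^ t * j"
  have s2: "2 * real s \<le> \<epsilon> * real n" using Suc.prems by (simp add: s_def)
  then have "real (2 ^ t * j) \<le> \<epsilon> * real n" unfolding s_def by linarith
  then obtain X1 V1 X2 V2 where forests: "disjoint_forests f t s X1 V1 X2 V2"
    using Suc.IH s_def by blast
  note forest1 = alternating_forestD[OF disjoint_forestsD(1)[OF forests]]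
    and forest2 = alternating_forestD[OF disjoint_forestsD(2)[OF forests]]
  let ?W = "{..<N} - (V1 \<union> V2)"
  have "1 \<le> s" "4 * real s \<le> \<epsilon> * real N" using j s2 by (simp_all add: s_def N_eq mult_ac)
  then have "6 * s \<le> card {a \<in> ?W. \<exists>x\<in>X1. E x a}" "6 * s \<le> card {a \<in> ?W. \<exists>x\<in>X2. E x a}"
    using card_new_neighbours_ge[of X1 ?W] card_new_neighbours_ge[of X2 ?W]
      forest1(1,2,5) forest2(1,2,5) card_outside_forests[OF forests] by auto
  from disjoint_forests_step[OF f forests this] show ?case by (simp add: s_def mult.assoc)
qed

lemma card_long_augmenting_ge:
  assumes f: "f \<in> matchings j" and j: "1 \<le> j"
    and t: "real (2 ^ t * j) \<le> \<epsilon> * real n" "\<epsilon> * real n \<le> 2 * real (2 ^ t * j)"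
  shows "real N / 11 \<le> card (augmenting f (2 * t + 1))"
proof -
  define s where "s = 2 ^ t * j"
  obtain X1 V1 X2 V2 where forests: "disjoint_forests f t s X1 V1 X2 V2"
    using disjoint_forests_exist[OF f j t(1)] s_def by blast
  note forest1 = alternating_forestD[OF disjoint_forestsD(1)[OF forests]]
    and forest2 = alternating_forestD[OF disjoint_forestsD(2)[OF forests]]
  let ?W = "{..<N} - (V1 \<union> V2)"
  have s0: "0 < real s" using j by (simp add: s_def)
  have few: "real (card (non_neighbours X ?W)) \<le> (\<epsilon> * N)\<^sup>2 / s" if "X \<subseteq> {..<N}" "card X = s" for X
    using card_non_neighbours_le[OF that(1), of ?W] that(2) s0 by (simp add: field_simps)
  have "2 * real s \<le> \<epsilon> * N" "\<epsilon> * N \<le> 4 * real s"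
    using t by (simp_all add: s_def N_eq mult_ac)
  then have "(\<epsilon> * N - 4 * real s) * (\<epsilon> * N - real s) \<le> 0"
    using s0 by (intro mult_nonpos_nonneg) auto
  then have "8 * real s * real s + 2 * (\<epsilon> * N)\<^sup>2 \<le> 10 * (\<epsilon> * N) * real s"
    by (simp add: power2_eq_square algebra_simps)
  then have "8 * real s + 2 * ((\<epsilon> * N)\<^sup>2 / s) \<le> 10 * (\<epsilon> * N)"
    using s0 by (simp add: field_simps)
  moreover have "\<epsilon> * N \<le> N / 11" by (intro eps_mult_le) simp
  moreover have "f ` ?W \<subseteq> ?W" using outside_forests(1)[OF f forests] by blast
  then have "card ?W - card (non_neighbours X1 ?W) - card (non_neighbours X2 ?W)
      \<le> card (joining_vertices f X1 X2 ?W)"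
    by (intro card_minus_non_neighbours_le[OF f]) auto
  moreover have "X1 \<subseteq> {..<N}" "X2 \<subseteq> {..<N}" using forest1(1,2) forest2(1,2) by auto
  ultimately show ?thesis
    using few[OF _ forest1(5)] few[OF _ forest2(5)] card_outside_forests[OF forests]
      card_joining_vertices_le[OF f forests]
    by linarith
qed

end

section \<open>Counting\<close>

lemma sum_floor_log_div_le: "(\<Sum>j=1..q. floor_log (q div j)) \<le> q"
proof (induction q rule: less_induct)
  case (less q)
  show ?case
  proof (cases "q = 0")
    case False
    let ?h = "q div 2"
    have "(\<Sum>j=1..q. floor_log (q div j)) = (\<Sum>j=1..?h. floor_log (q div j))"
    proof (rule sum.mono_neutral_right)
      show "\<forall>j\<in>{1..q} - {1..?h}. floor_log (q div j) = 0"
      proof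
        fix j assume "j \<in> {1..q} - {1..?h}"
        then have "q div j = 1" by (intro div_nat_eqI) auto
        then show "floor_log (q div j) = 0" by simp
      qed
    qed auto
    also have "\<dots> = (\<Sum>j=1..?h. Suc (floor_log (?h div j)))"
    proof (rule sum.cong)
      fix j assume "j \<in> {1..?h}"
      then have "2 * j \<le> q" "j > 0" by auto
      then have "q div j \<ge> 2" by (simp add: less_eq_div_iff_mult_less_eq)
      then have "floor_log (q div j) = Suc (floor_log (q div j div 2))" by (rule floor_log_rec)
      also have "q div j div 2 = ?h div j" by (simp add: div_mult2_eq[symmetric] mult.commute)
      finally show "floor_log (q div j) = Suc (floor_log (?h div j))" .
    qed simp
    also have "\<dots> = (\<Sum>j=1..?h. floor_log (?h div j)) + ?h" by (simp add: sum_Suc)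
    also have "\<dots> \<le> ?h + ?h" using less.IH[of ?h] False by simp
    also have "\<dots> \<le> q" by simp
    finally show ?thesis .
  qed simp
qed

lemma power_le_exp_fact:
  fixes x :: real
  assumes "0 \<le> x"
  shows "x ^ n \<le> exp x * fact n"
proof -
  have "(\<Sum>k\<in>{n}. x ^ k /\<^sub>R fact k) \<le> (\<Sum>k. x ^ k /\<^sub>R fact k)"
    using assms by (intro sum_le_suminf sums_summable[OF exp_converges]) auto
  also have "\<dots> = exp x" by (rule sums_unique[OF exp_converges, symmetric])
  finally have "x ^ n / fact n \<le> exp x" by (simp add: field_simps)
  then show ?thesis by (simp add: pos_divide_le_eq)
qed

lemma Suc_times_binomial_Suc: "Suc k * (m choose Suc k) = (m - k) * (m choose k)"
  by (simp only: binomial_absorption binomial_absorb_comp)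

lemma power_mult_fact_Suc_le:
  assumes "c * q \<le> n"
  shows "c ^ q * fact (Suc q) \<le> (2 * n) ^ q"
proof -
  have "c ^ q * fact (Suc q) = c ^ q * fact q * Suc q" by (simp add: algebra_simps)
  also have "\<dots> \<le> c ^ q * q ^ q * 2 ^ q"
    using fact_le_power[of q, where 'a = nat] by (intro mult_mono Suc_leI less_exp) auto
  also have "\<dots> = 2 ^ q * (c * q) ^ q" by (simp add: power_mult_distrib)
  also have "\<dots> \<le> 2 ^ q * n ^ q" using assms by (intro mult_left_mono power_mono) auto
  finally show ?thesis by (simp add: power_mult_distrib)
qed

lemma greedy_product_ge:
  fixes d :: real
  assumes d: "0 < d" and q: "c * q \<le> n" "q < n"
  shows "(d / exp 1) ^ n * (real c / 2) ^ q / d ^ (q + 1)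
    \<le> (d / real n) ^ (n - q - 1) * (fact n / fact (q + 1)) / real n"
proof -
  define r where "r = d / real n"
  have n0: "0 < real n" and r0: "0 < r" using q(2) d by (auto simp: r_def)
  have "real (c ^ q * fact (Suc q)) \<le> real ((2 * n) ^ q)"
    using power_mult_fact_Suc_le[OF q(1)] by (simp only: of_nat_le_iff)
  then have "real c ^ q * fact (q + 1) \<le> real n ^ q * 2 ^ q"
    by (simp add: power_mult_distrib mult.commute del: fact_Suc)
  then have "real c ^ q / 2 ^ q \<le> real n ^ q / fact (q + 1)"
    by (subst pos_divide_le_eq) (simp_all add: pos_le_divide_eq del: fact_Suc)
  then have factorial: "(real c / 2) ^ q \<le> real n ^ q / fact (q + 1)" by (simp only: power_divide)
  have "(d / exp 1) ^ n = r ^ n * (real n ^ n / exp (real n))"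
    using n0 by (simp add: r_def power_divide exp_of_nat_mult[symmetric])
  also have "\<dots> \<le> r ^ n * fact n"
    using power_le_exp_fact[of "real n" n] r0
    by (intro mult_left_mono) (auto simp: pos_divide_le_eq mult.commute)
  finally have "(d / exp 1) ^ n * (real c / 2) ^ q / d ^ (q + 1)
      \<le> r ^ n * fact n * (real n ^ q / fact (q + 1)) / d ^ (q + 1)"
    using factorial d r0 by (intro divide_right_mono mult_mono) auto
  also have "r ^ n = r ^ (n - q - 1) * r ^ (q + 1)"
    using q(2) by (simp only: power_add[symmetric]) simp
  also have "r ^ (n - q - 1) * r ^ (q + 1) * fact n * (real n ^ q / fact (q + 1)) / d ^ (q + 1)
      = r ^ (n - q - 1) * (fact n / fact (q + 1)) * (r ^ (q + 1) * real n ^ q / d ^ (q + 1))"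
    by (simp add: divide_inverse mult_ac del: fact_Suc power_Suc)
  also have "r ^ (q + 1) * real n ^ q / d ^ (q + 1) = 1 / real n"
    using n0 d by (simp add: r_def power_divide)
  finally show ?thesis by (simp add: r_def)
qed

lemma expander_factor_bound:
  fixes d x \<epsilon> :: real
  assumes d: "1 \<le> d" and \<epsilon>: "0 < \<epsilon>" "\<epsilon> \<le> 1 / 4" and x: "1 / 2 \<le> x" "real q \<le> x"
  shows "(\<epsilon> / (2 * exp 1 ^ 3 * d ^ 6)) powr x \<le> 1 / (2 * 2 ^ q * d ^ (4 * q + 1))"
proof -
  have d0: "d > 0" using d by simp
  have "\<epsilon> / (2 * exp 1 ^ 3 * d ^ 6) = (\<epsilon> / exp 1 ^ 3) * ((1 / 2) * (1 / d ^ 6))" by simp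
  then have "(\<epsilon> / (2 * exp 1 ^ 3 * d ^ 6)) powr x
      = (\<epsilon> / exp 1 ^ 3) powr x * ((1 / 2) powr x * (1 / d ^ 6) powr x)"
    using \<epsilon> d0 by (simp only: powr_mult)
  also have "\<dots> \<le> 1 / 2 * (1 / 2 ^ q * (1 / d ^ (4 * q + 1)))"
  proof (intro mult_mono)
    have "1 \<le> exp (1 :: real) ^ 3" by (intro one_le_power) simp
    then have "\<epsilon> \<le> 1 / 4 * exp 1 ^ 3" using \<epsilon>(2) by linarith
    then have "\<epsilon> / exp 1 ^ 3 \<le> 1 / 4" by (simp add: pos_divide_le_eq)
    then have "(\<epsilon> / exp 1 ^ 3) powr x \<le> (1 / 4) powr x" using \<epsilon> x by (intro powr_mono2) auto
    also have "\<dots> \<le> (1 / 4) powr (1 / 2)" using x by (intro powr_mono') auto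
    also have "\<dots> = 1 / 2" by (simp add: powr_half_sqrt real_sqrt_divide)
    finally show "(\<epsilon> / exp 1 ^ 3) powr x \<le> 1 / 2" .
    have "(1 / 2 :: real) powr x \<le> (1 / 2) powr (real q)" using x by (intro powr_mono') auto
    also have "\<dots> = 1 / 2 ^ q" by (simp add: powr_realpow power_one_over)
    finally show "(1 / 2 :: real) powr x \<le> 1 / 2 ^ q" .
    have "1 / d ^ 6 = d powr (- 6)" using d0 by (simp add: powr_minus divide_inverse)
    then have "(1 / d ^ 6) powr x = d powr (- (6 * x))" by (simp add: powr_powr)
    also have "\<dots> \<le> d powr (- real (4 * q + 1))" using x d by (intro powr_mono) auto
    also have "\<dots> = 1 / d ^ (4 * q + 1)" using d0 by (simp only: powr_minus_divide powr_realpow)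
    finally show "(1 / d ^ 6) powr x \<le> 1 / d ^ (4 * q + 1)" .
  qed (use d0 in auto)
  also have "\<dots> = 1 / (2 * 2 ^ q * d ^ (4 * q + 1))" by simp
  finally show ?thesis .
qed

context strong_expander
begin

abbreviation num_matchings :: "nat \<Rightarrow> real" where
  "num_matchings j \<equiv> real (card (matchings j))"

lemma card_augmenting_0_ge:
  assumes f: "f \<in> matchings j"
  shows "2 * real d * real j * (real j - \<epsilon> * real n) / real n \<le> card (augmenting f 0)"
proof -
  let ?e = "real (card (edge_pairs (unmatched f) (unmatched f)))"
  have "2 * real d * real j * (real j - \<epsilon> * real n) / real n
      \<le> 2 * real d * real j * (real j - \<epsilon> * real n) / real n
        + 2 * real d * real j * (\<epsilon> * real j) / real n"
    using eps_pos by simp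
  also have "\<dots> = d * (2 * real j) * (2 * real j / N - \<epsilon> * (1 - 2 * real j / N))"
    using n_pos by (simp add: real_N field_simps)
  also have "\<dots> \<le> ?e"
    using internal_edges_bound[OF unmatched_subset, of f] matchingsD(3)[OF f] by simp
  also have "\<dots> \<le> card (augmenting f 0)" using card_edge_pairs_unmatched_le by simp
  finally show ?thesis .
qed

lemma num_matchings_greedy_step:
  assumes q: "\<epsilon> * real n < real q + 1" and j: "q + 1 \<le> Suc j" "Suc j \<le> n"
  shows "num_matchings (Suc j) * (real d / real n * real (Suc j) * real (j - q))
    \<le> num_matchings j * real (n - j)"
proof -
  let ?c = "2 * real d * real (Suc j) * real (j - q) / real n"
  have "?c \<le> card (augmenting f 0)" if f: "f \<in> matchings (Suc j)" for f
  proof -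
    have "?c \<le> 2 * real d * real (Suc j) * (real (Suc j) - \<epsilon> * real n) / real n"
      using q j by (intro divide_right_mono mult_left_mono) (auto simp: of_nat_diff)
    then show ?thesis using card_augmenting_0_ge[OF f] by linarith
  qed
  then have "num_matchings (Suc j) * ?c \<le> num_matchings j * ((real N - 2 * real j) * real d ^ 0)"
    using j by (intro card_matchings_Suc_le) (auto simp: N_eq)
  also have "\<dots> = 2 * (num_matchings j * real (n - j))"
    using j by (simp add: real_N of_nat_diff algebra_simps)
  also have "num_matchings (Suc j) * ?c
      = 2 * (num_matchings (Suc j) * (real d / real n * real (Suc j) * real (j - q)))" by simp
  finally show ?thesis by linarith
qed

lemma num_matchings_greedy:
  assumes q: "\<epsilon> * real n < real q + 1" and "a + q + 1 \<le> n"
  shows "(real d / real n) ^ a * (fact n / fact (n - a)) * (n - q - 1 choose a)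
    \<le> num_matchings (n - a)"
  using assms(2)
proof (induction a)
  case 0
  have "0 < card (matchings n)"
    using id_in_matchings[OF N_eq] finite_matchings card_gt_0_iff by blast
  then show ?case by simp
next
  case (Suc a)
  define j where "j = n - Suc a"
  have j: "n - a = Suc j" "j - q = n - q - 1 - a" "n - j = Suc a"
    and qj: "q + 1 \<le> Suc j" "Suc j \<le> n"
    using Suc.prems by (auto simp: j_def)
  define r F where "r = real d / real n" and "F = r ^ a * (fact n / fact (Suc j))"
  have "fact n / fact j = fact n / fact (Suc j) * real (Suc j)"
    by (simp add: field_simps del: of_nat_Suc)
  then have "r ^ Suc a * (fact n / fact j) * (n - q - 1 choose Suc a) * real (Suc a)
      = F * r * real (Suc j) * real (Suc a * (n - q - 1 choose Suc a))"
    by (simp only: F_def power_Suc of_nat_mult mult_ac)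
  also have "\<dots> = F * (n - q - 1 choose a) * (r * real (Suc j) * real (j - q))"
    unfolding Suc_times_binomial_Suc j(2) by simp
  also have "\<dots> \<le> num_matchings (Suc j) * (r * real (Suc j) * real (j - q))"
    using Suc by (intro mult_right_mono) (auto simp: F_def r_def j(1))
  also have "\<dots> \<le> num_matchings j * real (Suc a)"
    using num_matchings_greedy_step[OF q qj] by (simp only: r_def j(3))
  finally show ?case
    by (simp only: r_def j_def mult_le_cancel_right_pos of_nat_0_less_iff zero_less_Suc)
qed

lemma num_matchings_descent:
  assumes q: "real q \<le> \<epsilon> * real n" "\<epsilon> * real n < real q + 1" and j: "Suc j \<le> q"
  shows "num_matchings (Suc j)
    \<le> num_matchings j * (11 * real d ^ (2 * floor_log (q div Suc j) + 1))"
proof -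
  define t where "t = floor_log (q div Suc j)"
  have "q div Suc j > 0" using j by (simp add: div_greater_zero_iff)
  then have "2 ^ t * Suc j \<le> q"
    using floor_log_exp2_le[of "q div Suc j"] by (simp add: t_def less_eq_div_iff_mult_less_eq)
  then have "real (2 ^ t * Suc j) \<le> real q" by (simp only: of_nat_le_iff)
  then have lower: "real (2 ^ t * Suc j) \<le> \<epsilon> * real n" using q(1) by linarith
  have "q < 2 * (2 ^ t * Suc j)"
    using floor_log_exp2_gt[of "q div Suc j"] by (simp add: t_def div_less_iff_less_mult mult.assoc)
  then have "real q + 1 \<le> 2 * real (2 ^ t * Suc j)" by linarith
  then have upper: "\<epsilon> * real n \<le> 2 * real (2 ^ t * Suc j)" using q(2) by linarith
  have "real q \<le> real n" using q(1) eps_less_1 mult_right_mono[of \<epsilon> 1 "real n"] by linarith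
  then have "num_matchings (Suc j) * (real N / 11)
      \<le> num_matchings j * ((real N - 2 * real j) * real d ^ (2 * t + 1))"
    using card_long_augmenting_ge[OF _ _ lower upper] j
    by (intro card_matchings_Suc_le) (auto simp: N_eq)
  also have "\<dots> \<le> num_matchings j * (real N * real d ^ (2 * t + 1))"
    by (intro mult_left_mono mult_right_mono) auto
  also have "\<dots> = (num_matchings j * (11 * real d ^ (2 * t + 1))) * (real N / 11)" by simp
  finally show ?thesis
    unfolding t_def[symmetric] by (rule mult_right_le_imp_le) (use N_ge_2 in simp)
qed

lemma num_matchings_le_perfect:
  assumes q: "real q \<le> \<epsilon> * real n" "\<epsilon> * real n < real q + 1"
  shows "num_matchings q \<le> num_matchings 0 * (11 ^ q * real d ^ (3 * q))"
proof -
  define s where "s i = (\<Sum>j=1..i. 2 * floor_log (q div j) + 1)" for i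
  have "num_matchings i \<le> num_matchings 0 * (11 ^ i * real d ^ s i)" if "i \<le> q" for i
    using that
  proof (induction i)
    case (Suc i)
    let ?c = "11 * real d ^ (2 * floor_log (q div Suc i) + 1)"
    have "num_matchings (Suc i) \<le> num_matchings i * ?c"
      by (rule num_matchings_descent[OF q Suc.prems])
    also have "\<dots> \<le> num_matchings 0 * (11 ^ i * real d ^ s i) * ?c"
      using Suc by (intro mult_right_mono) auto
    also have "\<dots> = num_matchings 0 * (11 ^ Suc i * real d ^ s (Suc i))"
      by (simp add: s_def power_add mult_ac)
    finally show ?case .
  qed (simp add: s_def)
  then have "num_matchings q \<le> num_matchings 0 * (11 ^ q * real d ^ s q)" by simp
  also have "s q = 2 * (\<Sum>j=1..q. floor_log (q div j)) + q"
    by (simp add: s_def sum_Suc sum_distrib_left)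
  then have "s q \<le> 3 * q" using sum_floor_log_div_le[of q] by linarith
  then have "num_matchings 0 * (11 ^ q * real d ^ s q)
      \<le> num_matchings 0 * (11 ^ q * real d ^ (3 * q))"
    using d_pos by (intro mult_left_mono power_increasing) auto
  finally show ?thesis .
qed

lemma num_matchings_Suc_le:
  assumes q: "\<epsilon> * real n < real q + 1" "q < n"
  shows "num_matchings (Suc q) \<le> num_matchings q * (2 * real n)"
proof -
  have "1 \<le> card (augmenting f 0)" if f: "f \<in> matchings (Suc q)" for f
  proof -
    have "0 < 2 * real d * real (Suc q) * (real (Suc q) - \<epsilon> * real n) / real n"
      using q(1) d_pos n_pos by simp
    then show ?thesis using card_augmenting_0_ge[OF f] by linarith
  qed
  then have "num_matchings (Suc q) * 1 \<le> num_matchings q * ((real N - 2 * real q) * real d ^ 0)"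
    using q(2) by (intro card_matchings_Suc_le) (auto simp: N_eq)
  also have "\<dots> \<le> num_matchings q * (2 * real n)" by (intro mult_left_mono) (auto simp: real_N)
  finally show ?thesis by simp
qed

lemma num_matchings_greedy_ge:
  assumes q: "real q \<le> \<epsilon> * real n" "\<epsilon> * real n < real q + 1"
  shows "(real d / exp 1) ^ n * (11 / 2) ^ q / real d ^ (q + 1) \<le> 2 * num_matchings q"
proof -
  have "11 * real q \<le> real n" using q(1) eps_mult_le[of "real n"] by linarith
  then have q11: "11 * q \<le> n" by linarith
  then have qn: "q < n" using n_pos by linarith
  have "(real d / exp 1) ^ n * (11 / 2) ^ q / real d ^ (q + 1)
      \<le> (real d / real n) ^ (n - q - 1) * (fact n / fact (q + 1)) / real n"
    using greedy_product_ge[OF _ q11 qn, of "real d"] d_pos by simp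
  also have "\<dots> \<le> num_matchings (q + 1) / real n"
    using num_matchings_greedy[OF q(2), of "n - q - 1"] qn by (intro divide_right_mono) auto
  also have "\<dots> \<le> 2 * num_matchings q"
    using num_matchings_Suc_le[OF q(2) qn] n_pos by (simp add: pos_divide_le_eq mult_ac)
  finally show ?thesis .
qed

theorem num_perfect_matchings_bound:
  "(real d / exp 1) ^ n * (\<epsilon> / (2 * exp 1 ^ 3 * real d ^ 6)) powr (\<epsilon> * real n)
    \<le> num_perfect_matchings N E"
proof -
  define x q where "x = \<epsilon> * real n" and "q = nat \<lfloor>x\<rfloor>"
  let ?B = "(real d / exp 1) ^ n"
  have d: "1 \<le> real d" using d_pos by simp
  have x: "1 / 2 \<le> x" using eps_N_ge_1 by (simp add: x_def N_eq)
  then have q: "real q \<le> x" "x < real q + 1" by (auto simp: q_def)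
  have "?B * (1 / (2 * 2 ^ q * real d ^ (4 * q + 1))) * (11 ^ q * real d ^ (3 * q))
      = ?B * (11 / 2) ^ q / real d ^ (q + 1) / 2"
  proof -
    have "real d ^ (4 * q + 1) = real d ^ (3 * q) * real d ^ (q + 1)" by (simp flip: power_add)
    then show ?thesis using d by (simp add: power_divide)
  qed
  also have "\<dots> \<le> num_matchings q"
    using num_matchings_greedy_ge[OF q[unfolded x_def]]
    by (subst pos_divide_le_eq) (simp_all only: mult.commute zero_less_numeral)
  also have "\<dots> \<le> num_matchings 0 * (11 ^ q * real d ^ (3 * q))"
    by (rule num_matchings_le_perfect[OF q[unfolded x_def]])
  finally have "?B * (1 / (2 * 2 ^ q * real d ^ (4 * q + 1))) \<le> num_matchings 0"
    by (rule mult_right_le_imp_le) (use d in simp)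
  moreover have "?B * (\<epsilon> / (2 * exp 1 ^ 3 * real d ^ 6)) powr x
      \<le> ?B * (1 / (2 * 2 ^ q * real d ^ (4 * q + 1)))"
    using expander_factor_bound[OF d eps_pos _ x q(1)] eps_le by (intro mult_left_mono) auto
  ultimately show ?thesis using card_matchings_0_le by (simp add: x_def)
qed

end

theorem theorem1p4:
  fixes n d :: nat and E :: "nat \<Rightarrow> nat \<Rightarrow> bool" and \<epsilon> :: real
  assumes "n \<ge> 1" and "d \<ge> 1"
    and "0 < \<epsilon>" and "\<epsilon> \<le> 1 / 11"
    and "simple_graph (2 * n) E"
    and "regular (2 * n) E d"
    and "spectral_expander (2 * n) E \<epsilon>"
  shows "real (num_perfect_matchings (2 * n) E) \<ge>
           (real d / exp 1) ^ n * (\<epsilon> / (2 * exp 1 ^ 3 * real d ^ 6)) powr (\<epsilon> * real n)"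
proof -
  interpret strong_expander "2 * n" d E \<epsilon> n
    by unfold_locales (use assms in auto)
  show ?thesis by (rule num_perfect_matchings_bound)
qed

end
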